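(* Let $\tau>0$, $\epsilon>0$ and $i\in\mathbb{N}$, $i\ge1$. Let $\psi_h^{n,0},\psi_h^{n-1}\in V_h$ be given and let $\{\psi_h^{n,j}\}_{j=1}^{i+1}\subset V_h$ be Newton iterates, i.e. for all $j=1,\dots,i+1$ and all $v_h\in V_h$, $$(\theta'(\psi_h^{n,j-1})(\psi_h^{n,j}-\psi_h^{n,j-1}),v_h)+\tau\big(K(\theta(\psi_h^{n,j-1}))\nabla(\psi_h^{n,j}+z),\nabla v_h\big)+\tau\big((K\circ\theta)'(\psi_h^{n,j-1})\nabla(\psi_h^{n,j-1}+z)(\psi_h^{n,j}-\psi_h^{n,j-1}),\nabla v_h\big)=\tau(f^n,v_h)-(\theta(\psi_h^{n,j-1})-\theta(\psi_h^{n-1}),v_h).$$ Assume there is a constant $C_N^i\in[0,2)$ such that, a.e. in $\Omega$, $$\tau\,\big|K(\theta(\psi_h^{n,i}))^{-\frac12}(K\circ\theta)'(\psi_h^{n,i})\nabla(\psi_h^{n,i}+z)\big|^2\le (C_N^i)^2\,\theta'(\psi_h^{n,i}).$$ Let $\mathcal{T}_{\rm deg}^{i,\epsilon}:=\{E\in\mathcal{T}_h:\ \inf_E\theta'(\psi_h^{n,i})<\epsilon\}$ and let $\boldsymbol{\sigma}_N^i\in \mathbf{RT}_p(\mathcal{T}_h)\cap \mathbf{H}(\mathrm{div},\Omega)$ satisfy $$\nabla\cdot\boldsymbol{\sigma}_N^i=\begin{cases}\frac1\tau\Pi_h\big(\theta'(\psi_h^{n,i-1})(\psi_h^{n,i}-\psi_h^{n,i-1})-(\theta(\psi_h^{n,i})-\theta(\psi_h^{n,i-1}))\big)&\text{in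 }\mathcal{T}_{\rm deg}^{i,\epsilon},\\ 0&\text{otherwise.}\end{cases}$$ Then $$\left(\int_\Omega \theta'(\psi_h^{n,i})\,|\psi_h^{n,i+1}-\psi_h^{n,i}|^2+\tau\big|K(\theta(\psi_h^{n,i}))^{\frac12}\nabla(\psi_h^{n,i+1}-\psi_h^{n,i})\big|^2\right)^{\frac12}\le \eta_{N\to L}^i,$$ where $$\eta_{N\to L}^i:=\frac{2}{2-C_N^i}\left(\big[\eta_{N\to L}^{i,\rm poten}\big]^2+\tau\big[\eta_{N\to L}^{i,\rm flux}\big]^2\right)^{\frac12},$$ $$\eta_{N\to L}^{i,\rm poten}:=\left\|\theta'(\psi_h^{n,i})^{-\frac12}\Big(\theta'(\psi_h^{n,i-1})(\psi_h^{n,i}-\psi_h^{n,i-1})-\big(\theta(\psi_h^{n,i})-\theta(\psi_h^{n,i-1})\big)\Big)\right\|_{\mathcal{T}_h\setminus\mathcal{T}_{\rm deg}^{i,\epsilon}},$$ $$\eta_{N\to L}^{i,\rm flux}:=\left\|K(\theta(\psi_h^{n,i}))^{-\frac12}\Big[\big(K(\theta(\psi_h^{n,i}))-K(\theta(\psi_h^{n,i-1}))\big)\nabla(\psi_h^{n,i}+z)-(K\circ\theta)'(\psi_h^{n,i-1})(\psi_h^{n,i}-\psi_h^{n,i-1})\nabla(\psi_h^{n,i-1}+z)+\boldsymbol{\sigma}_N^i\Big]\right\|.$$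
   Context: Domain and spaces. $\Omega\subset\mathbb{R}^d$ is a bounded polygonal (polytopal) domain with Lipschitz boundary; $(\cdot,\cdot)$ and $\|\cdot\|$ are the $L^2(\Omega)$ inner product and norm (also for vector fields). $\mathcal{T}_h$ is a triangulation of $\Omega$ into closed $d$-simplices, $p\in\mathbb{N}$, $\mathcal{P}_p(E)$ is the space of polynomials of order $p$ on $E$, and $\mathcal{P}_p(\mathcal{T}_h)$ the space of functions that are elementwise in $\mathcal{P}_p$. $V_h:=\{v_h\in H_0^1(\Omega): v_h|_E\in\mathcal{P}_p(E)\ \forall E\in\mathcal{T}_h\}$. For a subset $\mathcal{S}\subset\mathcal{T}_h$, $\|\cdot\|_{\mathcal{S}}$ is the $L^2$ norm on the union of the elements in $\mathcal{S}$. $\Pi_h:L^2(\Omega)\to\mathcal{P}_p(\mathcal{T}_h)$ is the $L^2$ projection, $(\Pi_hu,v_h)=(u,v_h)$ for all $v_h\in\mathcal{P}_p(\mathcal{T}_h)$. $\mathbf{RT}_p(\mathcal{T}_h)$ is the $p$-th order (broken) Raviart-Thomas space: $\boldsymbol\sigma|_E\in(\mathcal{P}_p(E))^d+\mathbf{x}\,\mathcal{P}_p(E)$ for all $E\in\mathcal{T}_h$. Data. $z$ is the coordinate (height) function against the direction of gravity. $\theta:\mathbb{R}\to[0,1]$ is Lipschitz continuous with Lipschitz constant $L_\theta$ and monotonically increasing, with $\theta_m\ge0$ a lower bound for $\theta'$. The permeability tensor $K:[0,1]\to\mathbb{R}^{d\times d}$ (symmetric) satisfies, for constants $\kappa_M>\kappa_m\ge0$,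 $\kappa_m|\mathbf{y}|^2\le\mathbf{y}^{\rm T}K\mathbf{y}\le\kappa_M|\mathbf{y}|^2$ for all $\mathbf{y}\in\mathbb{R}^d$, and $K\circ\theta$ is Lipschitz continuous with constant $L_\kappa$. The inverse square root $K(\theta(\psi_h^{n,i}))^{-1/2}$ is understood to exist a.e. in $\Omega$. $\theta'$ and $(K\circ\theta)'$ denote the derivatives of these Lipschitz functions (fixed bounded Borel representatives, $\theta_m\le\theta'\le L_\theta$). The source is $f\in C(0,T;L^2(\Omega))$ and $f^n:=f(t_n)\in L^2(\Omega)$ where $t_n=n\tau$ is the current time step. *)

theory Defs
  imports "HOL-Analysis.Analysis"
begin

text \<open>Functions stand for their classes modulo null sets of the completed Lebesgue measure; only
  the values on the indicated domain matter. Norms take values in \<open>[0,\<infinity>]\<close>, so that the norm of a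
  function that is not square integrable is \<open>\<infinity>\<close>.\<close>

definition ennsqrt :: "ennreal \<Rightarrow> ennreal" where
  "ennsqrt a = (if a = \<infinity> then \<infinity> else ennreal (sqrt (enn2real a)))"

definition L2_norm :: "'a::euclidean_space set \<Rightarrow> ('a \<Rightarrow> 'b::euclidean_space) \<Rightarrow> ennreal" where
  "L2_norm S u = ennsqrt (\<integral>\<^sup>+ x. ennreal ((norm (u x))\<^sup>2) \<partial>lebesgue_on S)"

definition L2 :: "'a::euclidean_space set \<Rightarrow> ('a \<Rightarrow> 'b::euclidean_space) set" where
  "L2 S = {u \<in> borel_measurable (lebesgue_on S). L2_norm S u < \<infinity>}"

definition L2_inner ::
    "'a::euclidean_space set \<Rightarrow> ('a \<Rightarrow> 'b::euclidean_space) \<Rightarrow> ('a \<Rightarrow> 'b) \<Rightarrow> real" where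
  "L2_inner S u v = (\<integral>x. u x \<bullet> v x \<partial>lebesgue_on S)"

definition partial :: "'d::finite \<Rightarrow> (real^'d \<Rightarrow> real) \<Rightarrow> real^'d \<Rightarrow> real" where
  "partial k \<phi> x = frechet_derivative \<phi> (at x) (axis k 1)"

definition gradient :: "(real^'d::finite \<Rightarrow> real) \<Rightarrow> real^'d \<Rightarrow> real^'d" where
  "gradient \<phi> x = (\<chi> k. partial k \<phi> x)"

primrec C_diff :: "nat \<Rightarrow> (real^'d::finite \<Rightarrow> real) \<Rightarrow> bool" where
  "C_diff 0 \<phi> \<longleftrightarrow> continuous_on UNIV \<phi>"
| "C_diff (Suc m) \<phi> \<longleftrightarrow> \<phi> differentiable_on UNIV \<and> (\<forall>k. C_diff m (partial k \<phi>))"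

definition test_functions :: "(real^'d::finite) set \<Rightarrow> (real^'d \<Rightarrow> real) set" where
  "test_functions \<Omega> =
    {\<phi>. (\<forall>m. C_diff m \<phi>) \<and> compact (closure {x. \<phi> x \<noteq> 0}) \<and> closure {x. \<phi> x \<noteq> 0} \<subseteq> \<Omega>}"

text \<open>Weak gradients, weak divergences and \<open>L2\<close> projections are unique only up to null sets;
  \<open>SOME\<close> picks a representative.\<close>

definition has_weak_grad ::
    "(real^'d::finite) set \<Rightarrow> (real^'d \<Rightarrow> real) \<Rightarrow> (real^'d \<Rightarrow> real^'d) \<Rightarrow> bool" where
  "has_weak_grad \<Omega> u G \<longleftrightarrow> G \<in> L2 \<Omega> \<and>
    (\<forall>\<phi>\<in>test_functions \<Omega>. \<forall>k. L2_inner \<Omega> u (partial k \<phi>) = - L2_inner \<Omega> (\<lambda>x. G x $ k) \<phi>)"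

definition H1 :: "(real^'d::finite) set \<Rightarrow> (real^'d \<Rightarrow> real) set" where
  "H1 \<Omega> = {u \<in> L2 \<Omega>. \<exists>G. has_weak_grad \<Omega> u G}"

definition weak_grad :: "(real^'d::finite) set \<Rightarrow> (real^'d \<Rightarrow> real) \<Rightarrow> real^'d \<Rightarrow> real^'d" where
  "weak_grad \<Omega> u = (SOME G. has_weak_grad \<Omega> u G)"

definition H1_norm :: "(real^'d::finite) set \<Rightarrow> (real^'d \<Rightarrow> real) \<Rightarrow> ennreal" where
  "H1_norm \<Omega> u = ennsqrt ((L2_norm \<Omega> u)\<^sup>2 + (L2_norm \<Omega> (weak_grad \<Omega> u))\<^sup>2)"

definition H1_0 :: "(real^'d::finite) set \<Rightarrow> (real^'d \<Rightarrow> real) set" where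
  "H1_0 \<Omega> = {u \<in> H1 \<Omega>. \<forall>e>0. \<exists>\<phi>\<in>test_functions \<Omega>. H1_norm \<Omega> (\<lambda>x. u x - \<phi> x) < e}"

definition has_weak_div ::
    "(real^'d::finite) set \<Rightarrow> (real^'d \<Rightarrow> real^'d) \<Rightarrow> (real^'d \<Rightarrow> real) \<Rightarrow> bool" where
  "has_weak_div \<Omega> \<sigma> g \<longleftrightarrow> g \<in> L2 \<Omega> \<and>
    (\<forall>\<phi>\<in>test_functions \<Omega>. L2_inner \<Omega> \<sigma> (gradient \<phi>) = - L2_inner \<Omega> g \<phi>)"

definition H_div :: "(real^'d::finite) set \<Rightarrow> (real^'d \<Rightarrow> real^'d) set" where
  "H_div \<Omega> = {\<sigma> \<in> L2 \<Omega>. \<exists>g. has_weak_div \<Omega> \<sigma> g}"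

definition weak_div :: "(real^'d::finite) set \<Rightarrow> (real^'d \<Rightarrow> real^'d) \<Rightarrow> real^'d \<Rightarrow> real" where
  "weak_div \<Omega> \<sigma> = (SOME g. has_weak_div \<Omega> \<sigma> g)"

text \<open>Near each boundary point, \<open>\<Omega>\<close> is the strict epigraph, in some direction \<open>\<nu>\<close>, of a Lipschitz
  function \<open>\<gamma>\<close> of the component orthogonal to \<open>\<nu>\<close>.\<close>

definition lipschitz_boundary :: "(real^'d::finite) set \<Rightarrow> bool" where
  "lipschitz_boundary \<Omega> \<longleftrightarrow>
    (\<forall>a\<in>frontier \<Omega>. \<exists>\<nu> r L. \<exists>\<gamma>::real^'d \<Rightarrow> real.
      norm \<nu> = 1 \<and> r > 0 \<and> L-lipschitz_on UNIV \<gamma> \<and>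
      \<Omega> \<inter> ball a r = {x \<in> ball a r. \<gamma> (x - (x \<bullet> \<nu>) *\<^sub>R \<nu>) < x \<bullet> \<nu>})"

definition polytopal_lipschitz_domain :: "(real^'d::finite) set \<Rightarrow> bool" where
  "polytopal_lipschitz_domain \<Omega> \<longleftrightarrow>
    open \<Omega> \<and> connected \<Omega> \<and> \<Omega> \<noteq> {} \<and> bounded \<Omega> \<and>
    (\<exists>P. finite P \<and> (\<forall>E\<in>P. polytope E) \<and> closure \<Omega> = \<Union>P) \<and>
    lipschitz_boundary \<Omega>"

definition domain_triangulation :: "(real^'d::finite) set \<Rightarrow> (real^'d) set set \<Rightarrow> bool" where
  "domain_triangulation \<Omega> Th \<longleftrightarrow>
    triangulation Th \<and> (\<forall>E\<in>Th. int CARD('d) simplex E) \<and> \<Union>Th = closure \<Omega>"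

definition polys :: "nat \<Rightarrow> (real^'d::finite \<Rightarrow> real) set" where
  "polys p = {q. \<exists>c::('d \<Rightarrow> nat) \<Rightarrow> real.
     q = (\<lambda>x. \<Sum>\<alpha> | sum \<alpha> UNIV \<le> p. c \<alpha> * (\<Prod>k\<in>UNIV. (x $ k) ^ \<alpha> k))}"

definition broken_polys :: "(real^'d::finite) set set \<Rightarrow> nat \<Rightarrow> (real^'d \<Rightarrow> real) set" where
  "broken_polys Th p = {v. \<forall>E\<in>Th. \<exists>q\<in>polys p. AE x in lebesgue_on E. v x = q x}"

text \<open>The polynomial representation of the elements of \<open>fem_space\<close> is required at every point of the
  closed simplices, which selects the continuous representative. Infima of nonlinear expressions of
  such functions over closed simplices can thus be taken pointwise.\<close>

definition fem_space ::
    "(real^'d::finite) set \<Rightarrow> (real^'d) set set \<Rightarrow> nat \<Rightarrow> (real^'d \<Rightarrow> real) set" where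
  "fem_space \<Omega> Th p = {v \<in> H1_0 \<Omega>. \<forall>E\<in>Th. \<exists>q\<in>polys p. \<forall>x\<in>E. v x = q x}"

definition broken_RT :: "(real^'d::finite) set set \<Rightarrow> nat \<Rightarrow> (real^'d \<Rightarrow> real^'d) set" where
  "broken_RT Th p = {\<sigma>. \<forall>E\<in>Th. \<exists>a. \<exists>b\<in>polys p. (\<forall>k. (\<lambda>x. a x $ k) \<in> polys p) \<and>
     (AE x in lebesgue_on E. \<sigma> x = a x + b x *\<^sub>R x)}"

definition L2_projection :: "(real^'d::finite) set \<Rightarrow> (real^'d) set set \<Rightarrow> nat \<Rightarrow>
    (real^'d \<Rightarrow> real) \<Rightarrow> real^'d \<Rightarrow> real" where
  "L2_projection \<Omega> Th p u =
    (SOME w. w \<in> broken_polys Th p \<and>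
       (\<forall>v\<in>broken_polys Th p. L2_inner \<Omega> w v = L2_inner \<Omega> u v))"

definition sym_psd :: "real^'n^'n::finite \<Rightarrow> bool" where
  "sym_psd A \<longleftrightarrow> transpose A = A \<and> (\<forall>y. 0 \<le> y \<bullet> (A *v y))"

definition matrix_sqrt :: "real^'n^'n::finite \<Rightarrow> real^'n^'n" where
  "matrix_sqrt A = (SOME B. sym_psd B \<and> B ** B = A)"

definition matrix_inv_sqrt :: "real^'n^'n::finite \<Rightarrow> real^'n^'n" where
  "matrix_inv_sqrt A = matrix_inv (matrix_sqrt A)"

end

theory Submission
  imports Defs
begin

text \<open>
  Write \<open>w\<close> for the Newton increment \<open>\<psi> (i+1) - \<psi> i\<close>, \<open>\<theta>'\<close> for \<open>d\<theta>\<close> and \<open>K'\<close> for \<open>dK\<close>, both at \<open>\<psi> i\<close>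
  unless another iterate is named, \<open>K\<close> for the permeability at \<open>\<psi> i\<close>, \<open>G\<^sub>j\<close> for the gradient of
  \<open>\<psi> j + z\<close>, and \<open>R\<close> for the error made by linearising \<open>\<theta>\<close> between \<open>\<psi> (i-1)\<close> and \<open>\<psi> i\<close>.
  Subtracting the Newton equations of steps \<open>i+1\<close> and \<open>i\<close>
  eliminates the source and the old time level and leaves \<open>R\<close> and the analogous flux linearisation
  error as the only data. The equilibrated flux \<open>\<sigma>\<close> is built such that \<open>\<tau> (\<sigma>, \<nabla>v) = - (R, v)\<close> on the
  degenerate elements (\<open>flux_balance\<close>): this moves the part of \<open>R\<close> that cannot be divided by \<open>\<theta>'\<close> into
  the flux. Testing with \<open>w\<close> gives, with the flux residual \<open>F\<close> of the estimator,
  \<open>(\<theta>' w, w) + \<tau> (K \<nabla>w, \<nabla>w) = (R, w) on the nondegenerate elements - \<tau> (w K' G\<^sub>i, \<nabla>w) - \<tau> (F, \<nabla>w)\<close>.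

  Each term on the right is bounded pointwise by Young's inequality after inserting
  \<open>K\<^sup>1\<^sup>/\<^sup>2 K\<^sup>-\<^sup>1\<^sup>/\<^sup>2\<close> (\<open>pointwise_energy_bound\<close>). The convection term costs the fraction \<open>C / 2\<close> of the
  energy, so that with \<open>D = 1 - C / 2\<close> the weight \<open>D\<close> in the other two leaves exactly
  \<open>D / 2\<close> to absorb (\<open>energy_absorption\<close>); the square root of \<open>D\<^sup>2 \<cdot> energy \<le> \<eta>\<^sub>p\<^sub>o\<^sub>t\<^sub>e\<^sub>n\<^sup>2 + \<tau> \<eta>\<^sub>f\<^sub>l\<^sub>u\<^sub>x\<^sup>2\<close> is the claim.
  In \<open>energy_absorption\<close> the density of the flux estimator is an arbitrary nonnegative function. This
  avoids the question of how inverse square roots depend on the matrix: even without measurability,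
  the nonnegative integral of a function bounds that of every measurable function below it.

  The remaining work is to show that the objects picked by Hilbert choice are the intended ones.
  Positive semidefinite matrices have square roots by the spectral theorem (\<open>sym_psd_has_sqrt\<close>). Weak
  gradients are unique (\<open>has_weak_grad_unique\<close>), hence additive, by the fundamental lemma of the
  calculus of variations; this needs smooth cutoff functions, made here from \<open>exp (- c / t)\<close>.
  Green's formula for \<open>H1_0\<close> and \<open>H_div\<close> follows by density (\<open>weak_div_green\<close>), and the \<open>L2\<close> projection
  onto the broken polynomials exists since they are finite-dimensional modulo null sets
  (\<open>L2_projection_works\<close>).
\<close>

section \<open>Square roots of positive semidefinite matrices\<close>

text \<open>A maximiser \<open>x\<close> of the quadratic form \<open>y \<bullet> f y\<close> on the unit sphere of \<open>S\<close> is an eigenvector: with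
  \<open>l\<close> the maximum, the form of \<open>f - l\<close> is nonpositive on \<open>S\<close> and vanishes at \<open>x\<close>, and moving from \<open>x\<close> a
  small step in the direction \<open>f x - l *\<^sub>R x\<close> would make it positive unless this vector is zero.\<close>

lemma self_adjoint_eigenvector:
  fixes f :: "'a::euclidean_space \<Rightarrow> 'a"
  assumes lin: "linear f" and sa: "\<And>x y. f x \<bullet> y = x \<bullet> f y"
    and S: "subspace S" "f ` S \<subseteq> S" "S \<noteq> {0}"
  shows "\<exists>x\<in>S. \<exists>l. norm x = 1 \<and> f x = l *\<^sub>R x"
proof -
  have cont: "continuous_on A f" for A
    using lin by (simp add: linear_continuous_on linear_linear)
  obtain s where s: "s \<in> S" "s \<noteq> 0" using S subspace_0 by blast
  have "compact (sphere 0 1 \<inter> S)" using closed_subspace[OF S(1)] by (simp add: compact_Int_closed)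
  moreover have "(1 / norm s) *\<^sub>R s \<in> sphere 0 1 \<inter> S" using s S(1) by (auto simp: subspace_scale)
  ultimately obtain x where x: "x \<in> sphere 0 1 \<inter> S"
    and mx: "\<And>y. y \<in> sphere 0 1 \<inter> S \<Longrightarrow> y \<bullet> f y \<le> x \<bullet> f x"
    using continuous_attains_sup[of "sphere 0 1 \<inter> S" "\<lambda>y. y \<bullet> f y"]
      continuous_on_inner[OF continuous_on_id cont] by blast
  define l where "l = x \<bullet> f x"
  have q: "y \<bullet> f y \<le> l * (y \<bullet> y)" if "y \<in> S" for y
  proof (cases "y = 0")
    case False
    then have "((1 / norm y) *\<^sub>R y) \<bullet> f ((1 / norm y) *\<^sub>R y) \<le> l"
      unfolding l_def using that S(1) by (intro mx) (auto simp: subspace_scale)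
    then have "(y \<bullet> f y) / (norm y)\<^sup>2 \<le> l"
      by (simp add: linear_cmul[OF lin] power2_eq_square)
    with False show ?thesis by (simp add: pos_divide_le_eq power2_norm_eq_inner)
  qed (simp add: linear_0[OF lin])
  define h where "h = f x - l *\<^sub>R x"
  have hS: "h \<in> S" unfolding h_def using x S by (auto intro!: subspace_diff subspace_scale)
  have xx: "x \<bullet> x = 1" using x by (simp add: dot_square_norm)
  have main: "2 * t * (h \<bullet> h) + t\<^sup>2 * (h \<bullet> f h - l * (h \<bullet> h)) \<le> 0" for t
  proof -
    have "(x + t *\<^sub>R h) \<in> S" using x hS S by (auto intro!: subspace_add subspace_scale)
    from q[OF this] have "(x + t *\<^sub>R h) \<bullet> f (x + t *\<^sub>R h) \<le> l * ((x + t *\<^sub>R h) \<bullet> (x + t *\<^sub>R h))" .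
    moreover have "f (x + t *\<^sub>R h) = f x + t *\<^sub>R f h" by (simp add: linear_add[OF lin] linear_cmul[OF lin])
    moreover have "x \<bullet> f h = f x \<bullet> h" by (simp add: sa)
    moreover have "f x = h + l *\<^sub>R x" by (simp add: h_def)
    moreover have "h \<bullet> x = 0" using xx by (simp add: h_def l_def inner_diff_left inner_commute[of "f x"])
    ultimately show ?thesis using xx
      by (simp add: inner_add_left inner_add_right algebra_simps power2_eq_square inner_commute)
  qed
  have "h \<bullet> h \<le> 0"
  proof (rule ccontr)
    assume "\<not> h \<bullet> h \<le> 0"
    then have pos: "h \<bullet> h > 0" by (simp only: not_le)
    \<comment> \<open>The step is so short that the term linear in \<open>t\<close> dominates the quadratic one.\<close>
    define c where "c = \<bar>h \<bullet> f h - l * (h \<bullet> h)\<bar> + 1"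
    define t where "t = (h \<bullet> h) / c"
    have c: "c > 0" by (simp add: c_def)
    have t: "t > 0" using pos c by (simp add: t_def)
    have "t\<^sup>2 * (h \<bullet> f h - l * (h \<bullet> h)) \<ge> t\<^sup>2 * (- c)"
      by (intro mult_left_mono) (auto simp: c_def)
    moreover have "t\<^sup>2 * c = t * (h \<bullet> h)" using c by (simp add: t_def power2_eq_square)
    ultimately have "2 * t * (h \<bullet> h) - t * (h \<bullet> h) \<le> 0" using main[of t] by simp
    then show False using mult_pos_pos[OF t pos] by simp
  qed
  then have "h = 0" by (metis inner_eq_zero_iff inner_ge_zero order_antisym)
  then have "f x = l *\<^sub>R x" by (simp add: h_def)
  then show ?thesis using x by auto
qed

text \<open>Split off one eigenvector; its orthogonal complement in \<open>S\<close> is again invariant because \<open>f\<close> is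
  self-adjoint, and its dimension is smaller.\<close>

lemma self_adjoint_orthonormal_eigenbasis:
  fixes f :: "'a::euclidean_space \<Rightarrow> 'a"
  assumes lin: "linear f" and sa: "\<And>x y. f x \<bullet> y = x \<bullet> f y"
  shows "subspace S \<Longrightarrow> f ` S \<subseteq> S \<Longrightarrow>
    \<exists>B. finite B \<and> pairwise orthogonal B \<and> (\<forall>b\<in>B. norm b = 1 \<and> (\<exists>l. f b = l *\<^sub>R b)) \<and> span B = S"
proof (induction "dim S" arbitrary: S rule: less_induct)
  case less
  show ?case
  proof (cases "S = {0}")
    case True
    then show ?thesis by (intro exI[of _ "{}"]) auto
  next
    case False
    obtain x l where x: "x \<in> S" "norm x = 1" "f x = l *\<^sub>R x"
      using self_adjoint_eigenvector[OF lin sa less.prems False] by blast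
    define S' where "S' = {y\<in>S. x \<bullet> y = 0}"
    have sub: "subspace S'" using less.prems(1) unfolding S'_def subspace_def by (auto simp: inner_add_right)
    have inv: "f ` S' \<subseteq> S'"
    proof
      fix y assume "y \<in> f ` S'"
      then obtain s where s: "s \<in> S'" "y = f s" by blast
      have "x \<bullet> f s = f x \<bullet> s" by (simp add: sa)
      then show "y \<in> S'" using s less.prems(2) x by (auto simp: S'_def)
    qed
    have "x \<notin> S'" using x by (auto simp: S'_def)
    moreover have "S' \<subseteq> S" by (auto simp: S'_def)
    ultimately have "S' \<subset> S" using x(1) by blast
    then have "dim S' < dim S" using sub less.prems(1) by (metis dim_psubset span_eq_iff)
    from less.hyps[OF this sub inv] obtain B where B: "finite B" "pairwise orthogonal B"
      "\<forall>b\<in>B. norm b = 1 \<and> (\<exists>l. f b = l *\<^sub>R b)" "span B = S'" by blast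
    have BS: "B \<subseteq> S'" using B(4) span_superset by blast
    have "span (insert x B) = S"
    proof
      show "span (insert x B) \<subseteq> S"
        using BS x(1) less.prems(1) by (intro span_minimal) (auto simp: S'_def)
      show "S \<subseteq> span (insert x B)"
      proof
        fix y assume y: "y \<in> S"
        have "y - (x \<bullet> y) *\<^sub>R x \<in> S'"
          using y x less.prems(1)
          by (auto simp: S'_def inner_diff_right dot_square_norm intro!: subspace_diff subspace_scale)
        then have "y - (x \<bullet> y) *\<^sub>R x \<in> span B" using B(4) by simp
        then show "y \<in> span (insert x B)" by (auto simp: span_breakdown_eq)
      qed
    qed
    moreover have "pairwise orthogonal (insert x B)"
      using B(2) BS by (auto simp: pairwise_insert orthogonal_def S'_def inner_commute)
    ultimately show ?thesis using B x by (intro exI[of _ "insert x B"]) auto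
  qed
qed

text \<open>Take the square roots of the eigenvalues in an orthonormal eigenbasis.\<close>

lemma sym_psd_has_sqrt:
  fixes A :: "real^'n^'n::finite"
  assumes "sym_psd A"
  shows "\<exists>B. sym_psd B \<and> B ** B = A"
proof -
  have sym: "(A *v x) \<bullet> y = x \<bullet> (A *v y)" for x y
    using assms by (metis dot_lmul_matrix sym_psd_def transpose_matrix_vector)
  have "linear ((*v) A)" by simp
  from self_adjoint_orthonormal_eigenbasis[OF this sym, of UNIV]
  obtain B where B: "finite B" "pairwise orthogonal B" "\<And>b. b \<in> B \<Longrightarrow> norm b = 1"
    "\<forall>b\<in>B. \<exists>l. A *v b = l *\<^sub>R b" "span B = UNIV" by auto
  from B(4) obtain l where l: "\<And>b. b \<in> B \<Longrightarrow> A *v b = l b *\<^sub>R b" by metis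
  have l0: "l b \<ge> 0" if "b \<in> B" for b
  proof -
    have "0 \<le> b \<bullet> (A *v b)" using assms by (simp add: sym_psd_def)
    then show ?thesis using l[OF that] B(3)[OF that] by (simp add: dot_square_norm)
  qed
  define g where "g x = (\<Sum>b\<in>B. (sqrt (l b) * (x \<bullet> b)) *\<^sub>R b)" for x
  have ing: "g x \<bullet> b = sqrt (l b) * (x \<bullet> b)" if "b \<in> B" for x b
  proof -
    have "g x \<bullet> b = (\<Sum>c\<in>B. if c = b then sqrt (l b) * (x \<bullet> b) else 0)"
      unfolding g_def inner_sum_left using B(2,3) that
      by (intro sum.cong) (auto simp: pairwise_def orthogonal_def dot_square_norm)
    then show ?thesis using that B(1) by simp
  qed
  have expd: "(\<Sum>b\<in>B. (x \<bullet> b) *\<^sub>R b) = x" for x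
    using orthonormal_basis_expand[OF B(2,3) _ B(1)] B(5) by auto
  have lin: "linear g"
    unfolding g_def by (intro linearI)
      (simp_all add: inner_add_left algebra_simps sum.distrib scaleR_sum_right)
  have gg: "g (g x) = A *v x" for x
  proof -
    have "g (g x) = (\<Sum>b\<in>B. (x \<bullet> b) *\<^sub>R (A *v b))"
      unfolding g_def[of "g x"] using l0 by (intro sum.cong) (auto simp: ing l mult.assoc[symmetric])
    also have "\<dots> = A *v (\<Sum>b\<in>B. (x \<bullet> b) *\<^sub>R b)"
      by (simp add: linear_sum[OF matrix_vector_mul_linear] matrix_vector_mult_scaleR)
    finally show ?thesis by (simp add: expd)
  qed
  have gsym: "g x \<bullet> y = x \<bullet> g y" for x y
    unfolding g_def by (simp add: inner_sum_left inner_sum_right inner_commute algebra_simps)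
  have gpos: "0 \<le> x \<bullet> g x" for x
    unfolding g_def inner_sum_right using l0
    by (intro sum_nonneg) (simp add: mult.assoc)
  have mg: "matrix g *v x = g x" for x using lin by (simp add: matrix_works)
  have "transpose (matrix g) = matrix g"
  proof (rule matrix_eq[THEN iffD2], rule allI, rule vector_eq_rdot[THEN iffD1], rule allI)
    fix x z show "(transpose (matrix g) *v x) \<bullet> z = (matrix g *v x) \<bullet> z"
      by (simp only: transpose_matrix_vector dot_lmul_matrix mg gsym)
  qed
  moreover have "matrix g ** matrix g = A"
    by (rule matrix_eq[THEN iffD2]) (simp add: matrix_vector_mul_assoc[symmetric] mg gg)
  ultimately show ?thesis unfolding sym_psd_def by (intro exI[of _ "matrix g"]) (simp add: mg gpos)
qed

lemma matrix_sqrt_sym_psd: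
  assumes "sym_psd A"
  shows "sym_psd (matrix_sqrt A)" "matrix_sqrt A ** matrix_sqrt A = A"
  using someI_ex[OF sym_psd_has_sqrt[OF assms]] unfolding matrix_sqrt_def by auto

lemma sym_matrix_inner:
  fixes B :: "real^'n^'n::finite"
  assumes "transpose B = B"
  shows "(B *v x) \<bullet> y = x \<bullet> (B *v y)"
  using assms by (metis dot_lmul_matrix transpose_matrix_vector)

lemma norm_matrix_sqrt:
  assumes "sym_psd A"
  shows "(norm (matrix_sqrt A *v y))\<^sup>2 = y \<bullet> (A *v y)"
proof -
  have "(norm (matrix_sqrt A *v y))\<^sup>2 = y \<bullet> (matrix_sqrt A *v (matrix_sqrt A *v y))"
    using matrix_sqrt_sym_psd[OF assms] by (simp add: power2_norm_eq_inner sym_matrix_inner sym_psd_def)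
  then show ?thesis using matrix_sqrt_sym_psd[OF assms] by (simp add: matrix_vector_mul_assoc)
qed

text \<open>This splitting distributes a degenerate coefficient evenly over the two factors of a
  flux-gradient product, as needed to bound the product by the energy.\<close>

lemma inner_matrix_inv_sqrt:
  assumes "sym_psd A" "invertible (matrix_sqrt A)"
  shows "x \<bullet> y = (matrix_inv_sqrt A *v x) \<bullet> (matrix_sqrt A *v y)"
proof -
  have "x = matrix_sqrt A *v (matrix_inv_sqrt A *v x)"
    using someI_ex[OF assms(2)[unfolded invertible_def]]
    by (simp add: matrix_inv_sqrt_def matrix_inv_def matrix_vector_mul_assoc)
  then show ?thesis using matrix_sqrt_sym_psd(1)[OF assms(1)]
    by (metis sym_matrix_inner sym_psd_def)
qed

section \<open>Square integrable functions\<close>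

lemma ennsqrt_less_top: "ennsqrt a < \<infinity> \<longleftrightarrow> a < \<infinity>"
  by (auto simp: ennsqrt_def top.not_eq_extremum)

lemma ennsqrt_power2: "(ennsqrt a)\<^sup>2 = a"
  by (cases a) (auto simp: ennsqrt_def ennreal_power)

lemma L2_iff:
  "u \<in> L2 S \<longleftrightarrow> u \<in> borel_measurable (lebesgue_on S) \<and> integrable (lebesgue_on S) (\<lambda>x. (norm (u x))\<^sup>2)"
  unfolding L2_def L2_norm_def mem_Collect_eq ennsqrt_less_top
  by (auto simp: integrable_iff_bounded)

lemma L2_measurable: "u \<in> L2 S \<Longrightarrow> u \<in> borel_measurable (lebesgue_on S)"
  by (simp add: L2_iff)

lemma L2_norm_power2:
  "u \<in> L2 S \<Longrightarrow> (L2_norm S u)\<^sup>2 = ennreal (\<integral>x. (norm (u x))\<^sup>2 \<partial>lebesgue_on S)"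
  unfolding L2_norm_def ennsqrt_power2 by (simp add: L2_iff nn_integral_eq_integral)

lemma L2_inner_integrable:
  assumes "u \<in> L2 S" "v \<in> L2 S"
  shows "integrable (lebesgue_on S) (\<lambda>x. u x \<bullet> v x)"
proof (rule Bochner_Integration.integrable_bound)
  show "integrable (lebesgue_on S) (\<lambda>x. (norm (u x))\<^sup>2 + (norm (v x))\<^sup>2)"
    using assms by (auto simp: L2_iff)
  show "(\<lambda>x. u x \<bullet> v x) \<in> borel_measurable (lebesgue_on S)"
    using assms by (auto simp: L2_iff)
  have "\<bar>u x \<bullet> v x\<bar> \<le> (norm (u x))\<^sup>2 + (norm (v x))\<^sup>2" for x
  proof -
    have "\<bar>u x \<bullet> v x\<bar> \<le> norm (u x) * norm (v x)" by (rule Cauchy_Schwarz_ineq2)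
    moreover have "2 * (norm (u x) * norm (v x)) \<le> (norm (u x))\<^sup>2 + (norm (v x))\<^sup>2"
      using sum_squares_bound[of "norm (u x)" "norm (v x)"] by simp
    moreover have "0 \<le> norm (u x) * norm (v x)" by simp
    ultimately show ?thesis by linarith
  qed
  then show "AE x in lebesgue_on S. norm (u x \<bullet> v x) \<le> norm ((norm (u x))\<^sup>2 + (norm (v x))\<^sup>2)"
    by (auto intro!: AE_I2 order_trans[OF _ abs_ge_self])
qed

lemma L2_add:
  assumes "u \<in> L2 S" "v \<in> L2 S"
  shows "(\<lambda>x. u x + v x) \<in> L2 S"
proof -
  have "integrable (lebesgue_on S) (\<lambda>x. (norm (u x))\<^sup>2 + 2 * (u x \<bullet> v x) + (norm (v x))\<^sup>2)"
    using assms by (intro Bochner_Integration.integrable_add integrable_mult_right L2_inner_integrable) (auto simp: L2_iff)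
  also have "(\<lambda>x. (norm (u x))\<^sup>2 + 2 * (u x \<bullet> v x) + (norm (v x))\<^sup>2) = (\<lambda>x. (norm (u x + v x))\<^sup>2)"
    by (simp add: power2_norm_eq_inner inner_add_left inner_add_right inner_commute[of "v x" "u x" for x] fun_eq_iff)
  finally have "integrable (lebesgue_on S) (\<lambda>x. (norm (u x + v x))\<^sup>2)" .
  then show ?thesis using assms by (auto simp: L2_iff)
qed

lemma L2_scale: "u \<in> L2 S \<Longrightarrow> (\<lambda>x. c *\<^sub>R u x) \<in> L2 S"
  by (auto simp: L2_iff power_mult_distrib)

lemma L2_diff: "u \<in> L2 S \<Longrightarrow> v \<in> L2 S \<Longrightarrow> (\<lambda>x. u x - v x) \<in> L2 S"
  using L2_add[OF _ L2_scale[of v S "-1"]] by simp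

lemma L2_dominated:
  assumes "u \<in> L2 S" "v \<in> borel_measurable (lebesgue_on S)"
    and "\<And>x. x \<in> S \<Longrightarrow> norm (v x) \<le> c * norm (u x)"
  shows "v \<in> L2 S"
proof -
  have "integrable (lebesgue_on S) (\<lambda>x. c\<^sup>2 * (norm (u x))\<^sup>2)" using assms by (auto simp: L2_iff)
  then have "integrable (lebesgue_on S) (\<lambda>x. (norm (v x))\<^sup>2)"
  proof (rule Bochner_Integration.integrable_bound)
    show "AE x in lebesgue_on S. norm ((norm (v x))\<^sup>2) \<le> norm (c\<^sup>2 * (norm (u x))\<^sup>2)"
      using power_mono[OF assms(3), of _ 2] by (auto simp: power_mult_distrib intro!: AE_I2)
  qed (use assms in auto)
  then show ?thesis using assms by (simp add: L2_iff)
qed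

lemma L2_bounded:
  assumes "S \<in> lmeasurable" "v \<in> borel_measurable (lebesgue_on S)"
    and "\<And>x. x \<in> S \<Longrightarrow> norm (v x) \<le> c"
  shows "v \<in> L2 S"
proof (rule L2_dominated[where u = "\<lambda>_. 1::real" and c = c])
  interpret finite_measure "lebesgue_on S" using assms(1) by (rule finite_measure_lebesgue_on)
  show "(\<lambda>_. 1::real) \<in> L2 S" by (simp add: L2_iff)
qed (use assms in auto)

lemma L2_nth:
  fixes G :: "'a::euclidean_space \<Rightarrow> real^'b::finite"
  assumes "G \<in> L2 S"
  shows "(\<lambda>x. G x $ k) \<in> L2 S"
proof (rule L2_dominated[OF assms, where c = 1])
  show "(\<lambda>x. G x $ k) \<in> borel_measurable (lebesgue_on S)"
    using borel_measurable_inner[OF L2_measurable[OF assms] borel_measurable_const[of "axis k 1 :: real^'b"]]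
    by (simp add: inner_axis)
  show "norm (G x $ k) \<le> 1 * norm (G x)" for x
    using component_le_norm_cart[of "G x" k] by simp
qed

lemma L2_integrable: "S \<in> lmeasurable \<Longrightarrow> (u :: _ \<Rightarrow> real) \<in> L2 S \<Longrightarrow> integrable (lebesgue_on S) u"
  using L2_inner_integrable[of u S "\<lambda>_. 1"] L2_bounded[of S "\<lambda>_. 1::real" 1] by simp

lemma L2_inner_add_left:
  "u \<in> L2 S \<Longrightarrow> v \<in> L2 S \<Longrightarrow> w \<in> L2 S \<Longrightarrow> L2_inner S (\<lambda>x. u x + v x) w = L2_inner S u w + L2_inner S v w"
  by (simp add: L2_inner_def inner_add_left L2_inner_integrable)

lemma L2_inner_diff_left:
  "u \<in> L2 S \<Longrightarrow> v \<in> L2 S \<Longrightarrow> w \<in> L2 S \<Longrightarrow> L2_inner S (\<lambda>x. u x - v x) w = L2_inner S u w - L2_inner S v w"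
  by (simp add: L2_inner_def inner_diff_left L2_inner_integrable)

lemma L2_inner_scale_left: "L2_inner S (\<lambda>x. c *\<^sub>R u x) w = c * L2_inner S u w"
  by (simp add: L2_inner_def)

lemma L2_inner_commute: "L2_inner S u v = L2_inner S v u"
  by (simp add: L2_inner_def inner_commute)

lemma L2_inner_diff_right:
  "u \<in> L2 S \<Longrightarrow> v \<in> L2 S \<Longrightarrow> w \<in> L2 S \<Longrightarrow> L2_inner S w (\<lambda>x. u x - v x) = L2_inner S w u - L2_inner S w v"
  by (simp add: L2_inner_commute[of S w] L2_inner_diff_left)

text \<open>Integrated Young inequality; with \<open>s\<close> free it serves in place of the Cauchy-Schwarz inequality.\<close>

lemma L2_inner_young:
  assumes "u \<in> L2 S" "v \<in> L2 S" "s > 0"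
  shows "2 * \<bar>L2_inner S u v\<bar> \<le> s * (\<integral>x. (norm (u x))\<^sup>2 \<partial>lebesgue_on S) + (\<integral>x. (norm (v x))\<^sup>2 \<partial>lebesgue_on S) / s"
proof -
  let ?M = "lebesgue_on S"
  have pw: "2 * \<bar>u x \<bullet> v x\<bar> \<le> s * (norm (u x))\<^sup>2 + (norm (v x))\<^sup>2 / s" for x
  proof -
    have "0 \<le> (sqrt s * norm (u x) - norm (v x) / sqrt s)\<^sup>2" by simp
    also have "\<dots> = s * (norm (u x))\<^sup>2 + (norm (v x))\<^sup>2 / s - 2 * (norm (u x) * norm (v x))"
      using assms(3) by (simp add: power2_diff power_mult_distrib power_divide)
    finally show ?thesis using Cauchy_Schwarz_ineq2[of "u x" "v x"] by linarith
  qed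
  have "2 * \<bar>L2_inner S u v\<bar> \<le> (\<integral>x. 2 * \<bar>u x \<bullet> v x\<bar> \<partial>?M)"
    using integral_norm_bound[of ?M "\<lambda>x. u x \<bullet> v x"] by (simp add: L2_inner_def)
  also have "\<dots> \<le> (\<integral>x. s * (norm (u x))\<^sup>2 + (norm (v x))\<^sup>2 / s \<partial>?M)"
    using assms pw by (intro integral_mono) (auto simp: L2_iff intro!: integrable_abs L2_inner_integrable)
  also have "\<dots> = s * (\<integral>x. (norm (u x))\<^sup>2 \<partial>?M) + (\<integral>x. (norm (v x))\<^sup>2 \<partial>?M) / s"
    using assms by (simp add: L2_iff)
  finally show ?thesis .
qed

lemma L2_inner_cong_AE:
  assumes "AE x in lebesgue_on S. u x \<bullet> v x = u' x \<bullet> v' x"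
    "(\<lambda>x. u x \<bullet> v x) \<in> borel_measurable (lebesgue_on S)" "(\<lambda>x. u' x \<bullet> v' x) \<in> borel_measurable (lebesgue_on S)"
  shows "L2_inner S u v = L2_inner S u' v'"
  unfolding L2_inner_def using assms by (intro integral_cong_AE) auto

lemma bounded_bilinear_matrix_vector_mult:
  "bounded_bilinear (\<lambda>A x. (A::real^'n^'m::finite) *v (x::real^'n::finite))"
  by (subst bilinear_conv_bounded_bilinear[symmetric])
    (auto simp: bilinear_def intro!: linearI
      simp: matrix_vector_mult_add_rdistrib matrix_vector_right_distrib matrix_vector_mult_scaleR scaleR_matrix_vector_assoc)

lemma matrix_vector_mult_L2:
  fixes A :: "'a::euclidean_space \<Rightarrow> real^'n^'m::finite" and G :: "'a \<Rightarrow> real^'n::finite"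
  assumes A: "A \<in> borel_measurable (lebesgue_on S)" "\<And>x. x \<in> S \<Longrightarrow> norm (A x) \<le> c" and G: "G \<in> L2 S"
  shows "(\<lambda>x. A x *v G x) \<in> L2 S"
proof -
  obtain k where k: "\<And>(a::real^'n^'m) (x::real^'n). norm (a *v x) \<le> norm a * norm x * k" "0 \<le> k"
    using bounded_bilinear.nonneg_bounded[OF bounded_bilinear_matrix_vector_mult] by blast
  show ?thesis
  proof (rule L2_dominated[OF G, where c = "c * k"])
    show "(\<lambda>x. A x *v G x) \<in> borel_measurable (lebesgue_on S)"
      using A(1) L2_measurable[OF G]
      by (intro borel_measurable_continuous_Pair[where H = "\<lambda>a y. a *v y"])
        (auto intro!: bounded_bilinear.continuous_on[OF bounded_bilinear_matrix_vector_mult] continuous_intros)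
    fix x assume "x \<in> S"
    have "norm (A x *v G x) \<le> norm (A x) * norm (G x) * k" by (rule k)
    also have "\<dots> \<le> c * norm (G x) * k"
      by (intro mult_right_mono A(2) \<open>x \<in> S\<close> k) auto
    finally show "norm (A x *v G x) \<le> c * k * norm (G x)" by (simp add: mult_ac)
  qed
qed

lemma bounded_scaleR_L2:
  fixes m :: "'a::euclidean_space \<Rightarrow> real" and u :: "'a \<Rightarrow> 'b::euclidean_space"
  assumes "m \<in> borel_measurable (lebesgue_on S)" "\<And>x. x \<in> S \<Longrightarrow> \<bar>m x\<bar> \<le> c" "u \<in> L2 S"
  shows "(\<lambda>x. m x *\<^sub>R u x) \<in> L2 S"
  by (rule L2_dominated[OF assms(3), where c = c])
    (use assms L2_measurable[OF assms(3)] in \<open>auto intro!: mult_right_mono\<close>)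

section \<open>Smooth cutoff functions of boxes\<close>

text \<open>The exponent \<open>m\<close> makes the family closed under differentiation: the derivative of a member is a
  linear combination of members, which yields smoothness without any formula for higher
  derivatives.\<close>

definition flat :: "real \<Rightarrow> nat \<Rightarrow> real \<Rightarrow> real" where
  "flat c m t = (if t > 0 then exp (- c / t) / t ^ m else 0)"

lemma exp_ge_power_over_fact: "0 \<le> u \<Longrightarrow> u ^ N / fact N \<le> exp (u::real)"
  using sum_le_suminf[OF summable_exp_generic[of u], of "{N}"] by (simp add: exp_def divide_inverse mult.commute)

lemma exp_minus_le_fact_over_power: "0 < u \<Longrightarrow> exp (- u) \<le> fact N / (u::real) ^ N"
  using exp_ge_power_over_fact[of u N] by (simp add: exp_minus field_simps)

text \<open>All members of the family vanish to second order at the origin, since \<open>exp (- c / t)\<close> decays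
  faster than any power of \<open>t\<close>. Hence they are differentiable there with derivative zero.\<close>

lemma flat_bound:
  assumes "c > 0"
  shows "\<bar>flat c m t\<bar> \<le> fact (m + 2) / c ^ (m + 2) * t\<^sup>2"
proof (cases "t > 0")
  case True
  have "exp (- (c / t)) \<le> fact (m + 2) / (c / t) ^ (m + 2)"
    using True assms by (intro exp_minus_le_fact_over_power) simp
  also have "\<dots> = fact (m + 2) / c ^ (m + 2) * (t\<^sup>2 * t ^ m)"
    by (simp add: power_divide power_add power2_eq_square mult_ac)
  finally show ?thesis using True
    by (simp add: flat_def pos_divide_le_eq mult_ac)
qed (simp add: flat_def assms less_imp_le)

lemma flat_deriv:
  assumes "c > 0"
  shows "(flat c m has_real_derivative c * flat c (m + 2) t - m * flat c (m + 1) t) (at t)"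
proof (cases t "0::real" rule: linorder_cases)
  case less
  have "((\<lambda>_. 0) has_real_derivative 0) (at t)" by simp
  then have "(flat c m has_real_derivative 0) (at t)"
    by (rule has_field_derivative_transform_within_open[of _ _ _ "{..<0}"]) (use less in \<open>auto simp: flat_def\<close>)
  then show ?thesis using less by (simp add: flat_def)
next
  case greater
  have "((\<lambda>t. exp (- c / t)) has_real_derivative c * (exp (- c / t) / t\<^sup>2)) (at t)"
    using greater by (auto intro!: derivative_eq_intros simp: field_simps power2_eq_square)
  moreover have "((\<lambda>t. t ^ m) has_real_derivative m * t ^ (m - 1)) (at t)"
    by (auto intro!: derivative_eq_intros)
  moreover have "(c * (exp (- c / t) / t\<^sup>2) * t ^ m - exp (- c / t) * (m * t ^ (m - 1))) / (t ^ m * t ^ m)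
      = c * (exp (- c / t) / t ^ (m + 2)) - m * (exp (- c / t) / t ^ (m + 1))"
    using greater by (cases m) (auto simp: field_simps power_add power2_eq_square)
  ultimately have "((\<lambda>t. exp (- c / t) / t ^ m) has_real_derivative
      c * (exp (- c / t) / t ^ (m + 2)) - m * (exp (- c / t) / t ^ (m + 1))) (at t)"
    using greater DERIV_divide[of "\<lambda>t. exp (- c / t)" _ t UNIV "\<lambda>t. t ^ m"] by fastforce
  then have "(flat c m has_real_derivative c * (exp (- c / t) / t ^ (m + 2)) - m * (exp (- c / t) / t ^ (m + 1))) (at t)"
    by (rule has_field_derivative_transform_within_open[of _ _ _ "{0<..}"]) (use greater in \<open>auto simp: flat_def\<close>)
  then show ?thesis using greater by (simp add: flat_def)
next
  case equal
  let ?C = "fact (m + 2) / c ^ (m + 2)"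
  have "((\<lambda>h. (flat c m (0 + h) - flat c m 0) / h) \<longlongrightarrow> 0) (at 0)"
  proof (rule Lim_null_comparison)
    show "\<forall>\<^sub>F h in at 0. norm ((flat c m (0 + h) - flat c m 0) / h) \<le> ?C * \<bar>h\<bar>"
    proof (rule eventually_at_filter[THEN iffD2], rule always_eventually, intro allI impI)
      fix h :: real assume "h \<noteq> 0"
      then show "norm ((flat c m (0 + h) - flat c m 0) / h) \<le> ?C * \<bar>h\<bar>"
        using flat_bound[OF assms, of m h] assms
        by (simp add: flat_def[of c m 0] pos_divide_le_eq power2_eq_square mult.assoc)
    qed
    show "((\<lambda>h. ?C * \<bar>h\<bar>) \<longlongrightarrow> 0) (at 0)"
      by (intro tendsto_mult_right_zero tendsto_rabs_zero tendsto_ident_at)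
  qed
  then show ?thesis using equal by (simp add: flat_def[of _ _ 0] DERIV_def)
qed

text \<open>An algebra of functions that is closed under partial derivatives, and hence consists of
  smooth functions.\<close>

inductive_set cutoff_algebra :: "(real^'d::finite \<Rightarrow> real) set" where
  const: "(\<lambda>x. a) \<in> cutoff_algebra"
| flat: "c > 0 \<Longrightarrow> (\<lambda>x. flat c m (s * x $ k + b)) \<in> cutoff_algebra"
| add: "f \<in> cutoff_algebra \<Longrightarrow> g \<in> cutoff_algebra \<Longrightarrow> (\<lambda>x. f x + g x) \<in> cutoff_algebra"
| mult: "f \<in> cutoff_algebra \<Longrightarrow> g \<in> cutoff_algebra \<Longrightarrow> (\<lambda>x. f x * g x) \<in> cutoff_algebra"

lemma partial_eqI: "(f has_derivative (\<lambda>h. \<Sum>k\<in>UNIV. g k * h $ k)) (at x) \<Longrightarrow> partial k f x = g k"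
  unfolding partial_def by (drule frechet_derivative_at[symmetric]) (simp add: axis_def if_distrib cong: if_cong)

lemma cutoff_algebra_derivative:
  assumes "f \<in> cutoff_algebra"
  shows "\<exists>g. (\<forall>k. g k \<in> cutoff_algebra) \<and> (\<forall>x. (f has_derivative (\<lambda>h. \<Sum>k\<in>UNIV. g k x * h $ k)) (at x))"
  using assms
proof induction
  case (const a)
  show ?case by (intro exI[of _ "\<lambda>k x. 0"]) (auto intro: cutoff_algebra.const)
next
  case (flat c m s k b)
  define g where "g = (\<lambda>x::real^'a. s * (c * flat c (m + 2) (s * x $ k + b) + (- real m) * flat c (m + 1) (s * x $ k + b)))"
  have g: "g \<in> cutoff_algebra" unfolding g_def by (intro cutoff_algebra.intros flat)
  have "((\<lambda>x. flat c m (s * x $ k + b)) has_derivative (\<lambda>h. g x * h $ k)) (at x)" for x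
  proof -
    have "((\<lambda>x. s * x $ k + b) has_derivative (\<lambda>h. s * h $ k)) (at x)"
      by (auto intro!: derivative_eq_intros bounded_linear.has_derivative[OF bounded_linear_vec_nth])
    from has_derivative_compose[OF this flat_deriv[OF flat, unfolded has_field_derivative_def]]
    show ?thesis by (simp add: g_def algebra_simps)
  qed
  moreover have "(\<Sum>j\<in>UNIV. (if j = k then g x else 0) * h $ j) = g x * h $ k" for x h
    by (simp add: if_distrib[of "\<lambda>a. a * _"] cong: if_cong)
  moreover have "(\<lambda>x. if j = k then g x else 0) \<in> cutoff_algebra" for j
    using g cutoff_algebra.const[of 0] by (cases "j = k") auto
  ultimately show ?case
    by (intro exI[of _ "\<lambda>j x. if j = k then g x else 0"]) auto
next
  case (add f1 f2)
  then obtain g1 g2 where g: "\<And>k. g1 k \<in> cutoff_algebra" "\<And>k. g2 k \<in> cutoff_algebra"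
    "\<And>x. (f1 has_derivative (\<lambda>h. \<Sum>k\<in>UNIV. g1 k x * h $ k)) (at x)"
    "\<And>x. (f2 has_derivative (\<lambda>h. \<Sum>k\<in>UNIV. g2 k x * h $ k)) (at x)" by blast
  show ?case
    by (intro exI[of _ "\<lambda>k x. g1 k x + g2 k x"])
      (auto intro!: derivative_eq_intros cutoff_algebra.intros g simp: sum.distrib algebra_simps)
next
  case (mult f1 f2)
  then obtain g1 g2 where g: "\<And>k. g1 k \<in> cutoff_algebra" "\<And>k. g2 k \<in> cutoff_algebra"
    "\<And>x. (f1 has_derivative (\<lambda>h. \<Sum>k\<in>UNIV. g1 k x * h $ k)) (at x)"
    "\<And>x. (f2 has_derivative (\<lambda>h. \<Sum>k\<in>UNIV. g2 k x * h $ k)) (at x)" by blast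
  show ?case
    by (intro exI[of _ "\<lambda>k x. f1 x * g2 k x + g1 k x * f2 x"])
      (auto intro!: derivative_eq_intros cutoff_algebra.intros g mult.hyps
        simp: sum.distrib algebra_simps sum_distrib_left)
qed

lemma cutoff_algebra_C_diff: "f \<in> cutoff_algebra \<Longrightarrow> C_diff m f"
proof (induction m arbitrary: f)
  case 0
  then show ?case using cutoff_algebra_derivative[OF 0] has_derivative_continuous
    by (fastforce simp: continuous_on_eq_continuous_at)
next
  case (Suc m)
  obtain g where g: "\<And>k. g k \<in> cutoff_algebra"
    "\<And>x. (f has_derivative (\<lambda>h. \<Sum>k\<in>UNIV. g k x * h $ k)) (at x)"
    using cutoff_algebra_derivative[OF Suc.prems] by blast
  have "partial k f = g k" for k by (rule ext, rule partial_eqI, rule g)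
  then show ?case using g Suc.IH
    by (auto simp: differentiable_on_def differentiable_def)
qed

text \<open>In each coordinate, both distances to the faces enter through \<open>exp (- c / t)\<close>. The result is
  smooth, and it increases to the indicator function of the open box as \<open>c = 1 / (n + 1)\<close>
  decreases to zero.\<close>

definition box_cutoff :: "nat \<Rightarrow> real^'d \<Rightarrow> real^'d \<Rightarrow> real^'d::finite \<Rightarrow> real" where
  "box_cutoff n a b x =
    (\<Prod>k\<in>UNIV. flat (1 / Suc n) 0 (x $ k - a $ k) * flat (1 / Suc n) 0 (b $ k - x $ k))"

lemma flat_0: "0 \<le> flat c 0 t" "c > 0 \<Longrightarrow> flat c 0 t \<le> 1" "flat c 0 t \<noteq> 0 \<longleftrightarrow> t > 0"
  by (auto simp: flat_def)

lemma box_cutoff_nonzero: "box_cutoff n a b x \<noteq> 0 \<longleftrightarrow> x \<in> box a b"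
  by (auto simp: box_cutoff_def mem_box_cart flat_0)

lemma box_cutoff_bounds: "0 \<le> box_cutoff n a b x" "box_cutoff n a b x \<le> 1"
  unfolding box_cutoff_def
  by (auto intro!: prod_nonneg prod_le_1 mult_nonneg_nonneg mult_le_one flat_0)

lemma box_cutoff_tendsto: "(\<lambda>n. box_cutoff n a b x) \<longlonglongrightarrow> indicator (box a b) x"
proof (cases "x \<in> box a b")
  case True
  have "(\<lambda>n. flat (1 / Suc n) 0 t) \<longlonglongrightarrow> 1" if "t > 0" for t
  proof -
    have "(\<lambda>n. exp (- ((1 / real (Suc n)) * (1 / t)))) \<longlonglongrightarrow> exp (- (0 * (1 / t)))"
      by (intro tendsto_intros LIMSEQ_Suc lim_1_over_n)
    then show ?thesis using that by (simp add: flat_def)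
  qed
  then have "(\<lambda>n. box_cutoff n a b x) \<longlonglongrightarrow> (\<Prod>k\<in>(UNIV::'a set). 1 * 1)"
    unfolding box_cutoff_def using True by (intro tendsto_prod tendsto_mult) (auto simp: mem_box_cart)
  with True show ?thesis by simp
next
  case False
  then have "box_cutoff n a b x = 0" for n using box_cutoff_nonzero by blast
  with False show ?thesis by simp
qed

lemma box_cutoff_test_function:
  assumes "cbox a b \<subseteq> \<Omega>"
  shows "box_cutoff n a b \<in> test_functions \<Omega>"
proof -
  have prod: "(\<lambda>x. \<Prod>k\<in>A. F k x) \<in> cutoff_algebra" if "finite A" "\<And>k. F k \<in> cutoff_algebra"
    for A :: "'a set" and F
    using that by (induction A) (auto intro: cutoff_algebra.intros)
  have "(\<lambda>x. flat (1 / Suc n) 0 (1 * x $ k + (- a $ k)) * flat (1 / Suc n) 0 ((-1) * x $ k + b $ k)) \<in> cutoff_algebra" for k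
    by (intro cutoff_algebra.intros) auto
  from prod[OF finite this] have "box_cutoff n a b \<in> cutoff_algebra"
    unfolding box_cutoff_def[abs_def] by simp
  moreover have "closure {x. box_cutoff n a b x \<noteq> 0} \<subseteq> cbox a b"
    unfolding box_cutoff_nonzero by (intro closure_minimal) (auto simp: box_subset_cbox)
  then have "compact (closure {x. box_cutoff n a b x \<noteq> 0})"
    by (meson bounded_cbox bounded_subset closed_closure compact_eq_bounded_closed)
  ultimately show ?thesis using assms \<open>closure _ \<subseteq> cbox a b\<close>
    unfolding test_functions_def by (auto simp: cutoff_algebra_C_diff)
qed

section \<open>Integration by parts against test functions\<close>

lemma integral_lebesgue_lborel:
  fixes f :: "'a::euclidean_space \<Rightarrow> real"
  assumes "f \<in> borel_measurable borel"
  shows "integral\<^sup>L lebesgue f = integral\<^sup>L lborel f"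
  using assms by (intro integral_completion) simp

lemma test_functionD:
  assumes "\<phi> \<in> test_functions \<Omega>"
  shows "\<phi> differentiable (at x)" "continuous_on UNIV \<phi>" "continuous_on UNIV (partial k \<phi>)"
proof -
  have C: "C_diff m \<phi>" for m using assms by (simp add: test_functions_def)
  show "\<phi> differentiable (at x)" using C[of 1] by (simp add: differentiable_on_def)
  show "continuous_on UNIV \<phi>" using C[of 0] by simp
  show "continuous_on UNIV (partial k \<phi>)" using C[of "Suc 0"] by simp
qed

lemma has_derivative_partial_scaleR:
  assumes "f differentiable (at (x + t *\<^sub>R axis k 1))"
  shows "((\<lambda>t. f (x + t *\<^sub>R axis k 1)) has_real_derivative partial k f (x + t *\<^sub>R axis k 1)) (at t)"
proof -
  let ?y = "x + t *\<^sub>R axis k 1" and ?D = "frechet_derivative f (at (x + t *\<^sub>R axis k 1))"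
  have "((\<lambda>t. x + t *\<^sub>R axis k 1) has_derivative (\<lambda>h. h *\<^sub>R axis k 1)) (at t)"
    by (auto intro!: derivative_eq_intros)
  moreover have d: "(f has_derivative ?D) (at ?y)" using assms frechet_derivative_works by blast
  ultimately have "((\<lambda>t. f (x + t *\<^sub>R axis k 1)) has_derivative (\<lambda>h. ?D (h *\<^sub>R axis k 1))) (at t)"
    by (rule has_derivative_compose)
  moreover have "?D (h *\<^sub>R axis k 1) = partial k f ?y * h" for h
    using linear_cmul[OF has_derivative_linear[OF d], of h "axis k 1"] by (simp add: partial_def)
  ultimately show ?thesis by (simp add: has_field_derivative_def)
qed

text \<open>The integral is translation invariant, so every difference quotient of \<open>f\<close> integrates to
  zero; the quotients converge boundedly on a fixed ball to the partial derivative.\<close>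

lemma integral_partial_eq_0:
  fixes f :: "real^'d::finite \<Rightarrow> real"
  assumes diff: "\<And>x. f differentiable (at x)" and cont: "continuous_on UNIV (partial k f)"
    and supp: "\<And>x. R < norm x \<Longrightarrow> f x = 0"
  shows "(\<integral>x. partial k f x \<partial>lborel) = 0"
proof -
  let ?e = "axis k 1 :: real^'d"
  have fc: "continuous_on UNIV f"
    using diff by (simp add: continuous_on_eq_continuous_at differentiable_imp_continuous_within)
  have p0: "partial k f x = 0" if "R < norm x" for x
  proof -
    have "((\<lambda>_. 0) has_derivative (\<lambda>_. 0)) (at x)" by simp
    then have "(f has_derivative (\<lambda>_. 0)) (at x)"
    proof (rule has_derivative_transform_within_open)
      show "open (- cball 0 R)" by (rule open_Compl) (rule closed_cball)
      show "x \<in> - cball 0 R" using that by simp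
      show "0 = f y" if "y \<in> - cball 0 R" for y by (rule supp[symmetric]) (use that in simp)
    qed
    from frechet_derivative_at[OF this, symmetric] show ?thesis by (simp add: partial_def)
  qed
  have "bounded (partial k f ` cball 0 R)"
    by (intro compact_imp_bounded compact_continuous_image continuous_on_subset[OF cont]) auto
  then obtain M where M: "M > 0" "\<And>x. x \<in> cball 0 R \<Longrightarrow> \<bar>partial k f x\<bar> \<le> M"
    unfolding bounded_pos by auto
  have M': "\<bar>partial k f x\<bar> \<le> M" for x
    using M p0[of x] by (cases "norm x \<le> R") auto
  define q where "q n x = (f (x + (1 / Suc n) *\<^sub>R ?e) - f x) / (1 / Suc n)" for n :: nat and x
  have fint: "integrable lborel f"
  proof -
    have "integrable lborel (\<lambda>x. indicator (cball 0 R) x *\<^sub>R f x)"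
      by (intro borel_integrable_compact continuous_on_subset[OF fc]) auto
    also have "(\<lambda>x. indicator (cball 0 R) x *\<^sub>R f x) = f"
      using supp by (auto simp: fun_eq_iff indicator_def)
    finally show ?thesis .
  qed
  have fb: "f \<in> borel_measurable borel" by (rule borel_measurable_continuous_onI[OF fc])
  have trans: "integrable lborel (\<lambda>x. f (x + c))" "(\<integral>x. f (x + c) \<partial>lborel) = (\<integral>x. f x \<partial>lborel)" for c
  proof -
    have *: "lborel = distr lborel borel ((+) c)" by (simp add: lborel_distr_plus)
    show "integrable lborel (\<lambda>x. f (x + c))"
      using fint fb by (subst (asm) *) (simp add: integrable_distr_eq add.commute)
    show "(\<integral>x. f (x + c) \<partial>lborel) = (\<integral>x. f x \<partial>lborel)"
      using fb by (subst (2) *) (simp add: integral_distr add.commute)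
  qed
  have q_int: "(\<integral>x. q n x \<partial>lborel) = 0" for n
    unfolding q_def using trans fint by simp
  have "(\<lambda>n. \<integral>x. q n x \<partial>lborel) \<longlonglongrightarrow> (\<integral>x. partial k f x \<partial>lborel)"
  proof (rule integral_dominated_convergence)
    show "integrable lborel (\<lambda>x. indicator (cball 0 (R + 1)) x *\<^sub>R M)"
      by (rule borel_integrable_compact) auto
    show "partial k f \<in> borel_measurable lborel"
      using borel_measurable_continuous_onI[OF cont] by simp
    show "q n \<in> borel_measurable lborel" for n
      unfolding q_def[abs_def] using fb by measurable
    show "AE x in lborel. (\<lambda>n. q n x) \<longlonglongrightarrow> partial k f x"
    proof (rule AE_I2)
      fix x
      have "((\<lambda>h. (f (x + h *\<^sub>R ?e) - f x) / h) \<longlongrightarrow> partial k f x) (at 0)"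
        using has_derivative_partial_scaleR[of f x 0 k] diff by (simp add: DERIV_def)
      moreover have "filterlim (\<lambda>n. 1 / real (Suc n)) (at 0) sequentially"
        by (simp add: filterlim_at LIMSEQ_Suc[OF lim_1_over_n] del: of_nat_Suc)
      ultimately show "(\<lambda>n. q n x) \<longlonglongrightarrow> partial k f x"
        unfolding q_def by (rule filterlim_compose)
    qed
    show "AE x in lborel. norm (q n x) \<le> indicator (cball 0 (R + 1)) x *\<^sub>R M" for n
    proof (rule AE_I2)
      fix x
      define h where "h = 1 / real (Suc n)"
      have h: "0 < h" "h \<le> 1" by (auto simp: h_def)
      show "norm (q n x) \<le> indicator (cball 0 (R + 1)) x *\<^sub>R M"
      proof (cases "norm x \<le> R + 1")
        case True
        have "((\<lambda>t. f (x + t *\<^sub>R ?e)) has_real_derivative partial k f (x + t *\<^sub>R ?e)) (at t)" for t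
          by (rule has_derivative_partial_scaleR[OF diff])
        from MVT2[OF h(1) this] obtain t where "f (x + h *\<^sub>R ?e) - f (x + 0 *\<^sub>R ?e) = (h - 0) * partial k f (x + t *\<^sub>R ?e)" by blast
        then have "q n x = partial k f (x + t *\<^sub>R ?e)"
          using h unfolding q_def h_def[symmetric] by simp
        then show ?thesis using M' True by simp
      next
        case False
        have "norm x \<le> norm (x + h *\<^sub>R ?e) + norm (h *\<^sub>R ?e)"
          by (metis add_diff_cancel_right' norm_triangle_ineq4)
        then have "norm (x + h *\<^sub>R ?e) > R" using False h by (simp add: norm_axis_1)
        then have "q n x = 0" using supp False h unfolding q_def h_def[symmetric] by simp
        then show ?thesis using M(1) by simp
      qed
    qed
  qed
  then show ?thesis by (simp add: q_int LIMSEQ_const_iff)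
qed

lemma partial_mult:
  assumes "f differentiable (at x)" "g differentiable (at x)"
  shows "partial k (\<lambda>x. f x * g x) x = f x * partial k g x + partial k f x * g x"
proof -
  have "((\<lambda>x. f x * g x) has_derivative
      (\<lambda>h. f x * frechet_derivative g (at x) h + frechet_derivative f (at x) h * g x)) (at x)"
    using assms by (intro has_derivative_mult) (auto simp: frechet_derivative_works)
  from frechet_derivative_at[OF this, symmetric] show ?thesis by (simp add: partial_def)
qed

text \<open>The product \<open>g \<cdot> \<phi>\<close> has compact support in \<open>\<Omega>\<close>, so its partial derivative integrates to zero over
  the whole space.\<close>

lemma integration_by_parts:
  fixes g :: "real^'d::finite \<Rightarrow> real"
  assumes \<Omega>: "open \<Omega>" and g: "\<And>x. g differentiable (at x)" "continuous_on UNIV (partial k g)"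
    and \<phi>: "\<phi> \<in> test_functions \<Omega>"
  shows "L2_inner \<Omega> g (partial k \<phi>) = - L2_inner \<Omega> (partial k g) \<phi>"
proof -
  let ?S = "closure {x. \<phi> x \<noteq> 0}"
  have gc: "continuous_on UNIV g"
    using g(1) by (simp add: continuous_on_eq_continuous_at differentiable_imp_continuous_within)
  have S: "compact ?S" "?S \<subseteq> \<Omega>" using \<phi> by (auto simp: test_functions_def)
  have \<phi>0: "\<phi> x = 0" if "x \<notin> ?S" for x
    using that closure_subset[of "{x. \<phi> x \<noteq> 0}"] by auto
  have p0: "partial k \<phi> x = 0" if "x \<notin> ?S" for x
  proof -
    have "((\<lambda>_. 0) has_derivative (\<lambda>_. 0)) (at x)" by simp
    then have "(\<phi> has_derivative (\<lambda>_. 0)) (at x)"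
    proof (rule has_derivative_transform_within_open)
      show "open (- ?S)" by (rule open_Compl) (rule closed_closure)
      show "x \<in> - ?S" using that by simp
      show "0 = \<phi> y" if "y \<in> - ?S" for y by (rule \<phi>0[symmetric]) (use that in simp)
    qed
    from frechet_derivative_at[OF this, symmetric] show ?thesis by (simp add: partial_def)
  qed
  have int: "integrable lborel (\<lambda>x. u x * v x)" "L2_inner \<Omega> u v = (\<integral>x. u x * v x \<partial>lborel)"
    if uv: "continuous_on UNIV u" "continuous_on UNIV v" "\<And>x. x \<notin> ?S \<Longrightarrow> v x = 0" for u v :: "real^'d \<Rightarrow> real"
  proof -
    have c: "continuous_on UNIV (\<lambda>x. u x * v x)" by (intro continuous_intros uv)
    have "integrable lborel (\<lambda>x. indicator ?S x *\<^sub>R (u x * v x))"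
      using S(1) by (intro borel_integrable_compact continuous_on_subset[OF c]) auto
    also have "(\<lambda>x. indicator ?S x *\<^sub>R (u x * v x)) = (\<lambda>x. u x * v x)"
      using uv(3) by (auto simp: fun_eq_iff indicator_def)
    finally show "integrable lborel (\<lambda>x. u x * v x)" .
    have "L2_inner \<Omega> u v = integral\<^sup>L lebesgue (\<lambda>x. indicator \<Omega> x *\<^sub>R (u x * v x))"
      unfolding L2_inner_def inner_real_def using \<Omega> by (intro integral_restrict_space) simp
    also have "(\<lambda>x. indicator \<Omega> x *\<^sub>R (u x * v x)) = (\<lambda>x. u x * v x)"
      using uv(3) S(2) by (auto simp: fun_eq_iff indicator_def)
    finally show "L2_inner \<Omega> u v = (\<integral>x. u x * v x \<partial>lborel)"
      using borel_measurable_continuous_onI[OF c] by (simp add: integral_lebesgue_lborel)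
  qed
  obtain R where R: "\<And>x. x \<in> ?S \<Longrightarrow> norm x \<le> R"
    using compact_imp_bounded[OF S(1)] unfolding bounded_iff by blast
  have pm: "partial k (\<lambda>x. g x * \<phi> x) = (\<lambda>x. g x * partial k \<phi> x + partial k g x * \<phi> x)"
    by (rule ext, rule partial_mult) (use g test_functionD[OF \<phi>] in auto)
  have "(\<integral>x. partial k (\<lambda>x. g x * \<phi> x) x \<partial>lborel) = 0"
  proof (rule integral_partial_eq_0[where R = R])
    show "(\<lambda>x. g x * \<phi> x) differentiable (at x)" for x
      using g test_functionD[OF \<phi>] by (intro differentiable_mult) auto
    show "continuous_on UNIV (partial k (\<lambda>x. g x * \<phi> x))"
      unfolding pm by (intro continuous_intros gc g test_functionD[OF \<phi>])
    show "g x * \<phi> x = 0" if "R < norm x" for x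
      using \<phi>0[of x] R[of x] that by (cases "x \<in> ?S") simp_all
  qed
  then show ?thesis unfolding pm
    using int[OF gc test_functionD(3)[OF \<phi>, of k] p0] int[OF g(2) test_functionD(2)[OF \<phi>] \<phi>0] by simp
qed

section \<open>The fundamental lemma of the calculus of variations\<close>

text \<open>The boxes are an intersection-stable generator of the Borel sets, so the signed measure with
  density \<open>f\<close> vanishes on every Borel subset of the box, in particular where \<open>f\<close> is positive and where
  it is negative.\<close>

lemma AE_eq_0_of_box_integrals:
  fixes f :: "'a::euclidean_space \<Rightarrow> real"
  assumes f: "integrable lborel f" and box: "\<And>c d. (\<integral>x. indicator (box a b \<inter> box c d) x * f x \<partial>lborel) = 0"
    and full: "(\<integral>x. indicator (box a b) x * f x \<partial>lborel) = 0"
  shows "AE x in lborel. x \<in> box a b \<longrightarrow> f x = 0"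
proof -
  have int: "integrable lborel (\<lambda>x. indicator A x * f x)" if "A \<in> sets borel" for A
    using integrable_mult_indicator[of A lborel f] that f by simp
  have fm: "f \<in> borel_measurable borel" using f by auto
  have zero: "(\<integral>x. indicator (box a b \<inter> A) x * f x \<partial>lborel) = 0" if "A \<in> sets borel" for A
  proof -
    let ?G = "range (\<lambda>(a, b). box a b :: 'a set)"
    have Int: "Int_stable ?G"
      by (auto simp: Int_stable_def Int_interval box_Int_box intro!: image_eqI)
    have "sets borel = sigma_sets UNIV ?G"
      by (subst borel_eq_box) simp
    then have sig: "sigma_sets UNIV ?G = sets borel" by simp
    then have A: "A \<in> sigma_sets UNIV ?G" using that by simp
    show ?thesis
      using Int subset_UNIV[of ?G, unfolded Pow_UNIV[symmetric]] A
    proof (induction rule: sigma_sets_induct_disjoint)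
      case (basic A)
      then show ?case using box by auto
    next
      case (compl A)
      then have "A \<in> sets borel" by (simp add: sig)
      have "(\<integral>x. indicator (box a b \<inter> (UNIV - A)) x * f x \<partial>lborel)
          = (\<integral>x. indicator (box a b) x * f x - indicator (box a b \<inter> A) x * f x \<partial>lborel)"
        by (intro Bochner_Integration.integral_cong) (auto simp: indicator_def)
      also have "\<dots> = 0" using int \<open>A \<in> sets borel\<close> compl.IH full by simp
      finally show ?case .
    next
      case (union A)
      have Am: "A i \<in> sets borel" for i using union(2) sig by blast
      have "(\<integral>x\<in>(\<Union>i. box a b \<inter> A i). f x \<partial>lborel) = (\<Sum>i. (\<integral>x\<in>(box a b \<inter> A i). f x \<partial>lborel))"
      proof (rule lebesgue_integral_countable_add)
        show "box a b \<inter> A i \<in> sets lborel" for i using Am by simp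
        show "i \<noteq> j \<Longrightarrow> (box a b \<inter> A i) \<inter> (box a b \<inter> A j) = {}" for i j
          using union(1) by (auto simp: disjoint_family_on_def)
        show "set_integrable lborel (\<Union>i. box a b \<inter> A i) f"
          unfolding set_integrable_def using int[of "\<Union>i. box a b \<inter> A i"] Am by simp
      qed
      then show ?case using union(3) by (simp add: set_lebesgue_integral_def)
    qed simp_all
  qed
  have sgn: "AE x in lborel. \<not> (x \<in> box a b \<and> 0 < s * f x)" for s
  proof -
    let ?A = "{x. 0 < s * f x}"
    have A: "?A \<in> sets borel" using fm by simp
    have "(\<integral>x. indicator (box a b \<inter> ?A) x * (s * f x) \<partial>lborel) = 0"
      using zero[OF A] by (simp add: mult.left_commute[of _ s])
    moreover have "integrable lborel (\<lambda>x. indicator (box a b \<inter> ?A) x * (s * f x))"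
      using int[of "box a b \<inter> ?A"] A by (simp add: mult.left_commute[of _ s])
    ultimately have "AE x in lborel. indicator (box a b \<inter> ?A) x * (s * f x) = 0"
      by (subst (asm) integral_nonneg_eq_0_iff_AE) (auto simp: indicator_def)
    then show ?thesis by eventually_elim (auto simp: indicator_def)
  qed
  from sgn[of 1] sgn[of "-1"] show ?thesis
    by eventually_elim force
qed

text \<open>Testing with the box cutoffs shows that \<open>g\<close> integrates to zero over all open boxes whose closure lies
  in \<open>\<Omega>\<close>, and countably many closed boxes exhaust \<open>\<Omega>\<close>.\<close>

lemma fundamental_lemma:
  fixes g :: "real^'d::finite \<Rightarrow> real"
  assumes \<Omega>: "open \<Omega>" and g: "integrable (lebesgue_on \<Omega>) g"
    and zero: "\<And>\<phi>. \<phi> \<in> test_functions \<Omega> \<Longrightarrow> L2_inner \<Omega> g \<phi> = 0"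
  shows "AE x in lebesgue_on \<Omega>. g x = 0"
proof -
  have \<Omega>m: "\<Omega> \<inter> space lebesgue \<in> sets lebesgue" using \<Omega> by simp
  have gi: "integrable lebesgue (\<lambda>x. indicator \<Omega> x *\<^sub>R g x)"
    using g integrable_restrict_space[OF \<Omega>m] by blast
  obtain f where f: "f \<in> borel_measurable lborel" "AE x in lborel. indicator \<Omega> x *\<^sub>R g x = f x"
    using completion_ex_borel_measurable_real[OF borel_measurable_integrable[OF gi]] by blast
  have fi: "integrable lborel f"
  proof -
    have "integrable lebesgue f"
      using gi f by (subst integrable_cong_AE[symmetric, OF _ _ AE_completion[OF f(2)]])
        (auto intro: borel_measurable_integrable measurable_completion[OF f(1)])
    then show ?thesis using integrable_completion[OF f(1)] by simp
  qed
  have f\<phi>: "(\<integral>x. f x * \<phi> x \<partial>lborel) = 0" if \<phi>: "\<phi> \<in> test_functions \<Omega>" for \<phi>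
  proof -
    have \<phi>m: "\<phi> \<in> borel_measurable borel"
      by (rule borel_measurable_continuous_onI[OF test_functionD(2)[OF \<phi>]])
    have "(\<integral>x. f x * \<phi> x \<partial>lborel) = (\<integral>x. f x * \<phi> x \<partial>lebesgue)"
      using f(1) \<phi>m by (intro integral_completion[symmetric]) simp
    also have "\<dots> = (\<integral>x. (indicator \<Omega> x *\<^sub>R g x) * \<phi> x \<partial>lebesgue)"
    proof (rule integral_cong_AE)
      show "AE x in lebesgue. f x * \<phi> x = indicator \<Omega> x *\<^sub>R g x * \<phi> x"
        using AE_completion[OF f(2)] by eventually_elim simp
      show "(\<lambda>x. f x * \<phi> x) \<in> borel_measurable lebesgue"
        using f(1) \<phi>m by (intro measurable_completion) simp
      show "(\<lambda>x. indicator \<Omega> x *\<^sub>R g x * \<phi> x) \<in> borel_measurable lebesgue"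
        using measurable_completion[of \<phi> lborel borel] \<phi>m
        by (intro borel_measurable_times borel_measurable_integrable[OF gi]) auto
    qed
    also have "\<dots> = L2_inner \<Omega> g \<phi>"
      unfolding L2_inner_def integral_restrict_space[OF \<Omega>m] by (simp add: mult.assoc)
    finally show ?thesis using zero[OF \<phi>] by simp
  qed
  have box0: "(\<integral>x. indicator (box a b) x * f x \<partial>lborel) = 0" if ab: "cbox a b \<subseteq> \<Omega>" for a b
  proof -
    have "(\<lambda>n. \<integral>x. f x * box_cutoff n a b x \<partial>lborel) \<longlonglongrightarrow> (\<integral>x. indicator (box a b) x * f x \<partial>lborel)"
    proof (rule integral_dominated_convergence)
      show "integrable lborel (\<lambda>x. norm (f x))" using fi by simp
      show "(\<lambda>x. indicator (box a b) x * f x) \<in> borel_measurable lborel" using f(1) by measurable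
      have "box_cutoff n a b \<in> borel_measurable borel" for n
        by (rule borel_measurable_continuous_onI[OF test_functionD(2)[OF box_cutoff_test_function[OF ab]]])
      then show "(\<lambda>x. f x * box_cutoff n a b x) \<in> borel_measurable lborel" for n using f(1) by simp
      show "AE x in lborel. (\<lambda>n. f x * box_cutoff n a b x) \<longlonglongrightarrow> indicator (box a b) x * f x"
        unfolding mult.commute[of "indicator _ _"]
        by (intro AE_I2 tendsto_mult_left box_cutoff_tendsto)
      show "AE x in lborel. norm (f x * box_cutoff n a b x) \<le> norm (f x)" for n
        using box_cutoff_bounds[of n a b]
        by (intro AE_I2) (simp add: abs_mult mult_left_le)
    qed
    then show ?thesis using f\<phi>[OF box_cutoff_test_function[OF ab]] by (simp add: LIMSEQ_const_iff)
  qed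
  have cb: "AE x in lborel. x \<in> cbox a b \<longrightarrow> f x = 0" if ab: "cbox a b \<subseteq> \<Omega>" for a b
  proof -
    have "AE x in lborel. x \<in> box a b \<longrightarrow> f x = 0"
    proof (rule AE_eq_0_of_box_integrals[OF fi])
      show "(\<integral>x. indicator (box a b) x * f x \<partial>lborel) = 0" by (rule box0[OF ab])
      fix c d
      obtain a' b' where *: "box a b \<inter> box c d = box a' b'" "cbox a b \<inter> cbox c d = cbox a' b'"
        unfolding box_Int_box Int_interval by blast
      then have "cbox a' b' \<subseteq> \<Omega>" using ab by blast
      then show "(\<integral>x. indicator (box a b \<inter> box c d) x * f x \<partial>lborel) = 0"
        unfolding * by (rule box0)
    qed
    moreover have "AE x in lborel. x \<notin> cbox a b - box a b"
      using negligible_frontier_interval[of a b]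
      by (intro AE_not_in) (simp add: negligible_iff_null_sets null_sets_completion_iff)
    ultimately show ?thesis by eventually_elim blast
  qed
  obtain D where D: "countable D" "D \<subseteq> Pow \<Omega>" "\<And>X. X \<in> D \<Longrightarrow> \<exists>a b. X = cbox a b" "\<Union>D = \<Omega>"
    using open_countable_Union_open_cbox[OF \<Omega>] by blast
  have "AE x in lborel. \<forall>X\<in>D. x \<in> X \<longrightarrow> f x = 0"
    using D cb by (subst AE_ball_countable) (auto, blast)
  with f(2) have "AE x in lborel. x \<in> \<Omega> \<longrightarrow> g x = 0"
  proof eventually_elim
    case (elim x)
    have "f x = 0" if "x \<in> \<Omega>" using that elim(2) D(4) by blast
    with elim(1) show ?case by (cases "x \<in> \<Omega>") auto
  qed
  then show ?thesis by (simp add: AE_restrict_space_iff[OF \<Omega>m] AE_completion)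
qed

section \<open>Weak gradients and Green's formula\<close>

lemma has_weak_gradD:
  "has_weak_grad \<Omega> u G \<Longrightarrow> G \<in> L2 \<Omega>"
  "has_weak_grad \<Omega> u G \<Longrightarrow> \<phi> \<in> test_functions \<Omega> \<Longrightarrow>
    L2_inner \<Omega> u (partial k \<phi>) = - L2_inner \<Omega> (\<lambda>x. G x $ k) \<phi>"
  by (simp_all add: has_weak_grad_def)

lemma continuous_L2:
  fixes g :: "real^'d::finite \<Rightarrow> 'b::euclidean_space"
  assumes "open \<Omega>" "bounded \<Omega>" "continuous_on UNIV g"
  shows "g \<in> L2 \<Omega>"
proof -
  have "bounded (g ` closure \<Omega>)"
    using assms by (intro compact_imp_bounded compact_continuous_image) (auto intro: continuous_on_subset)
  then obtain c where c: "\<And>x. x \<in> closure \<Omega> \<Longrightarrow> norm (g x) \<le> c" unfolding bounded_iff by blast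
  show ?thesis
  proof (rule L2_bounded)
    show "\<Omega> \<in> lmeasurable" using assms by (simp add: lmeasurable_open)
    show "g \<in> borel_measurable (lebesgue_on \<Omega>)"
      using assms by (intro continuous_imp_measurable_on_sets_lebesgue)
        (auto intro: continuous_on_subset)
    show "norm (g x) \<le> c" if "x \<in> \<Omega>" for x using c that closure_subset by blast
  qed
qed

lemma test_function_L2:
  assumes "open \<Omega>" "bounded \<Omega>" "\<phi> \<in> test_functions \<Omega>"
  shows "\<phi> \<in> L2 \<Omega>" "partial k \<phi> \<in> L2 \<Omega>" "gradient \<phi> \<in> L2 \<Omega>"
  using continuous_L2[OF assms(1,2)] test_functionD[OF assms(3)]
  by (auto simp: gradient_def[abs_def] intro!: continuous_L2[OF assms(1,2)] continuous_on_vec_lambda)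

lemma has_weak_grad_unique:
  assumes \<Omega>: "open \<Omega>" "bounded \<Omega>" and G: "has_weak_grad \<Omega> u G" "has_weak_grad \<Omega> u H"
  shows "AE x in lebesgue_on \<Omega>. G x = H x"
proof -
  have m: "\<Omega> \<in> lmeasurable" using \<Omega> by (simp add: lmeasurable_open)
  have "AE x in lebesgue_on \<Omega>. G x $ k - H x $ k = 0" for k
  proof (rule fundamental_lemma[OF \<Omega>(1)])
    have L: "(\<lambda>x. G x $ k) \<in> L2 \<Omega>" "(\<lambda>x. H x $ k) \<in> L2 \<Omega>"
      using G by (auto intro: L2_nth has_weak_gradD)
    show "integrable (lebesgue_on \<Omega>) (\<lambda>x. G x $ k - H x $ k)"
      by (intro L2_integrable[OF m] L2_diff L)
    fix \<phi> assume \<phi>: "\<phi> \<in> test_functions \<Omega>"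
    show "L2_inner \<Omega> (\<lambda>x. G x $ k - H x $ k) \<phi> = 0"
      using has_weak_gradD(2)[OF G(1) \<phi>, of k] has_weak_gradD(2)[OF G(2) \<phi>, of k]
      by (simp add: L2_inner_diff_left[OF L test_function_L2(1)[OF \<Omega> \<phi>]])
  qed
  then have "AE x in lebesgue_on \<Omega>. \<forall>k\<in>UNIV. G x $ k - H x $ k = 0"
    by (subst AE_ball_countable) auto
  then show ?thesis by eventually_elim (simp add: vec_eq_iff)
qed

lemma has_weak_grad_weak_grad: "has_weak_grad \<Omega> u G \<Longrightarrow> has_weak_grad \<Omega> u (weak_grad \<Omega> u)"
  unfolding weak_grad_def by (rule someI[where P = "has_weak_grad \<Omega> u"])

lemma has_weak_grad_add:
  assumes \<Omega>: "open \<Omega>" "bounded \<Omega>" and u: "u \<in> L2 \<Omega>" "v \<in> L2 \<Omega>"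
    and G: "has_weak_grad \<Omega> u G" "has_weak_grad \<Omega> v H"
  shows "has_weak_grad \<Omega> (\<lambda>x. u x + v x) (\<lambda>x. G x + H x)"
  unfolding has_weak_grad_def
  using test_function_L2[OF \<Omega>] G u
  by (auto intro!: L2_add simp: L2_inner_add_left L2_nth has_weak_gradD)

lemma has_weak_grad_diff:
  assumes \<Omega>: "open \<Omega>" "bounded \<Omega>" and u: "u \<in> L2 \<Omega>" "v \<in> L2 \<Omega>"
    and G: "has_weak_grad \<Omega> u G" "has_weak_grad \<Omega> v H"
  shows "has_weak_grad \<Omega> (\<lambda>x. u x - v x) (\<lambda>x. G x - H x)"
  unfolding has_weak_grad_def
  using test_function_L2[OF \<Omega>] G u
  by (auto intro!: L2_diff simp: L2_inner_diff_left L2_nth has_weak_gradD)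

text \<open>Applied to test functions, this identifies the weak gradients that occur in the \<open>H1\<close>-norm of
  \<open>v - \<phi>\<close>; applied to the height, it provides the weak gradient of \<open>\<psi> + z\<close>.\<close>

lemma has_weak_grad_classical:
  fixes g :: "real^'d::finite \<Rightarrow> real"
  assumes \<Omega>: "open \<Omega>" "bounded \<Omega>"
    and g: "\<And>x. g differentiable (at x)" "\<And>k. continuous_on UNIV (partial k g)"
  shows "g \<in> L2 \<Omega>" "has_weak_grad \<Omega> g (gradient g)"
proof -
  show "g \<in> L2 \<Omega>" using g(1)
    by (intro continuous_L2 \<Omega>) (simp add: continuous_on_eq_continuous_at differentiable_imp_continuous_within)
  show "has_weak_grad \<Omega> g (gradient g)"
    unfolding has_weak_grad_def
  proof (intro conjI ballI allI)
    show "gradient g \<in> L2 \<Omega>"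
      unfolding gradient_def[abs_def] by (intro continuous_L2 \<Omega> continuous_on_vec_lambda g)
    fix \<phi> k assume "\<phi> \<in> test_functions \<Omega>"
    from integration_by_parts[OF \<Omega>(1) g this]
    show "L2_inner \<Omega> g (partial k \<phi>) = - L2_inner \<Omega> (\<lambda>x. gradient g x $ k) \<phi>"
      by (simp add: gradient_def)
  qed
qed

lemma H1_D:
  assumes "u \<in> H1 \<Omega>"
  shows "u \<in> L2 \<Omega>" "has_weak_grad \<Omega> u (weak_grad \<Omega> u)" "weak_grad \<Omega> u \<in> L2 \<Omega>"
proof -
  show "u \<in> L2 \<Omega>" using assms by (simp add: H1_def)
  show "has_weak_grad \<Omega> u (weak_grad \<Omega> u)" using assms by (auto simp: H1_def intro: has_weak_grad_weak_grad)
  then show "weak_grad \<Omega> u \<in> L2 \<Omega>" by (rule has_weak_gradD)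
qed

lemma height_weak_grad:
  assumes \<Omega>: "open \<Omega>" "bounded \<Omega>"
  shows "(\<lambda>x. up \<bullet> x) \<in> L2 \<Omega>" "has_weak_grad \<Omega> (\<lambda>x. up \<bullet> x) (gradient (\<lambda>x. up \<bullet> x))"
proof -
  have d: "((\<lambda>x. up \<bullet> x) has_derivative (\<lambda>h. up \<bullet> h)) (at x)" for x
    by (auto intro!: derivative_eq_intros)
  have diff: "(\<lambda>x. up \<bullet> x) differentiable (at x)" for x using d by (auto simp: differentiable_def)
  have "partial k (\<lambda>x. up \<bullet> x) = (\<lambda>x. up \<bullet> axis k 1)" for k
    unfolding partial_def[abs_def] using frechet_derivative_at[OF d, symmetric] by simp
  then have "continuous_on UNIV (partial k (\<lambda>x. up \<bullet> x))" for k by simp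
  from has_weak_grad_classical[OF \<Omega> diff this]
  show "(\<lambda>x. up \<bullet> x) \<in> L2 \<Omega>" "has_weak_grad \<Omega> (\<lambda>x. up \<bullet> x) (gradient (\<lambda>x. up \<bullet> x))" by auto
qed

text \<open>Both sides are continuous in \<open>v\<close> with respect to the \<open>H1\<close>-norm, and for test functions the
  identity is the definition of the weak divergence.\<close>

lemma weak_div_green:
  assumes \<Omega>: "open \<Omega>" "bounded \<Omega>" and v: "v \<in> H1_0 \<Omega>" and \<sigma>: "\<sigma> \<in> H_div \<Omega>"
  shows "weak_div \<Omega> \<sigma> \<in> L2 \<Omega>" "L2_inner \<Omega> \<sigma> (weak_grad \<Omega> v) = - L2_inner \<Omega> (weak_div \<Omega> \<sigma>) v"
proof -
  let ?d = "weak_div \<Omega> \<sigma>"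
  obtain g where "has_weak_div \<Omega> \<sigma> g" using \<sigma> by (auto simp: H_div_def)
  then have "has_weak_div \<Omega> \<sigma> ?d"
    unfolding weak_div_def by (rule someI[where P = "has_weak_div \<Omega> \<sigma>"])
  then have d: "?d \<in> L2 \<Omega>"
    and green: "\<And>\<phi>. \<phi> \<in> test_functions \<Omega> \<Longrightarrow> L2_inner \<Omega> \<sigma> (gradient \<phi>) = - L2_inner \<Omega> ?d \<phi>"
    by (auto simp: has_weak_div_def)
  show "?d \<in> L2 \<Omega>" by (rule d)
  have s: "\<sigma> \<in> L2 \<Omega>" using \<sigma> by (simp add: H_div_def)
  have vH: "v \<in> H1 \<Omega>" and approx: "\<And>e. e > 0 \<Longrightarrow> \<exists>\<phi>\<in>test_functions \<Omega>. H1_norm \<Omega> (\<lambda>x. v x - \<phi> x) < e"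
    using v by (auto simp: H1_0_def)
  define S where "S = (\<integral>x. (norm (\<sigma> x))\<^sup>2 \<partial>lebesgue_on \<Omega>) + (\<integral>x. (norm (?d x))\<^sup>2 \<partial>lebesgue_on \<Omega>)"
  have S0: "S \<ge> 0" unfolding S_def by simp
  let ?r = "\<bar>L2_inner \<Omega> \<sigma> (weak_grad \<Omega> v) + L2_inner \<Omega> ?d v\<bar>"
  have bound: "2 * ?r \<le> e * (S + 1)" if e: "e > 0" for e
  proof -
    obtain \<phi> where \<phi>: "\<phi> \<in> test_functions \<Omega>" "H1_norm \<Omega> (\<lambda>x. v x - \<phi> x) < ennreal e"
      using approx[of "ennreal e"] e by auto
    let ?w = "\<lambda>x. v x - \<phi> x"
    have \<phi>g: "has_weak_grad \<Omega> \<phi> (gradient \<phi>)"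
      by (rule has_weak_grad_classical[OF \<Omega>]) (rule test_functionD[OF \<phi>(1)])+
    note \<phi>L = test_function_L2[OF \<Omega> \<phi>(1)]
    have wg: "has_weak_grad \<Omega> ?w (\<lambda>x. weak_grad \<Omega> v x - gradient \<phi> x)"
      by (rule has_weak_grad_diff[OF \<Omega> H1_D(1)[OF vH] \<phi>L(1) H1_D(2)[OF vH] \<phi>g])
    have wL: "?w \<in> L2 \<Omega>" by (rule L2_diff[OF H1_D(1)[OF vH] \<phi>L(1)])
    then have wH: "?w \<in> H1 \<Omega>" using wg by (auto simp: H1_def)
    have ae: "AE x in lebesgue_on \<Omega>. weak_grad \<Omega> ?w x = weak_grad \<Omega> v x - gradient \<phi> x"
      by (rule has_weak_grad_unique[OF \<Omega> H1_D(2)[OF wH] wg])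
    define W where "W = (\<integral>x. (norm (?w x))\<^sup>2 \<partial>lebesgue_on \<Omega>)"
    define Y where "Y = (\<integral>x. (norm (weak_grad \<Omega> ?w x))\<^sup>2 \<partial>lebesgue_on \<Omega>)"
    have "ennreal (W + Y) = (H1_norm \<Omega> ?w)\<^sup>2"
      unfolding H1_norm_def ennsqrt_power2 L2_norm_power2[OF wL] L2_norm_power2[OF H1_D(3)[OF wH]] W_def Y_def
      by (simp add: ennreal_plus)
    also have "\<dots> \<le> (ennreal e)\<^sup>2" using \<phi>(2) by (intro power_mono) auto
    finally have WY: "W + Y \<le> e\<^sup>2" using e by (simp add: ennreal_power)
    have "L2_inner \<Omega> \<sigma> (weak_grad \<Omega> ?w) = L2_inner \<Omega> \<sigma> (\<lambda>x. weak_grad \<Omega> v x - gradient \<phi> x)"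
    proof (rule L2_inner_cong_AE)
      show "AE x in lebesgue_on \<Omega>. \<sigma> x \<bullet> weak_grad \<Omega> ?w x = \<sigma> x \<bullet> (weak_grad \<Omega> v x - gradient \<phi> x)"
        using ae by eventually_elim simp
      show "(\<lambda>x. \<sigma> x \<bullet> weak_grad \<Omega> ?w x) \<in> borel_measurable (lebesgue_on \<Omega>)"
        by (intro borel_measurable_inner L2_measurable s H1_D(3)[OF wH])
      show "(\<lambda>x. \<sigma> x \<bullet> (weak_grad \<Omega> v x - gradient \<phi> x)) \<in> borel_measurable (lebesgue_on \<Omega>)"
        by (intro borel_measurable_inner borel_measurable_diff L2_measurable s H1_D(3)[OF vH] \<phi>L)
    qed
    also have "\<dots> = L2_inner \<Omega> \<sigma> (weak_grad \<Omega> v) - L2_inner \<Omega> \<sigma> (gradient \<phi>)"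
      by (rule L2_inner_diff_right[OF H1_D(3)[OF vH] \<phi>L(3) s])
    finally have "L2_inner \<Omega> \<sigma> (weak_grad \<Omega> v) + L2_inner \<Omega> ?d v
        = L2_inner \<Omega> \<sigma> (weak_grad \<Omega> ?w) + L2_inner \<Omega> ?d ?w"
      using green[OF \<phi>(1)] L2_inner_diff_right[OF H1_D(1)[OF vH] \<phi>L(1) d] by simp
    then have "2 * ?r \<le> 2 * \<bar>L2_inner \<Omega> \<sigma> (weak_grad \<Omega> ?w)\<bar> + 2 * \<bar>L2_inner \<Omega> ?d ?w\<bar>"
      using abs_triangle_ineq[of "L2_inner \<Omega> \<sigma> (weak_grad \<Omega> ?w)" "L2_inner \<Omega> ?d ?w"] by simp
    also have "\<dots> \<le> e * S + (Y + W) / e"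
      using L2_inner_young[OF s H1_D(3)[OF wH] e] L2_inner_young[OF d wL e]
      unfolding S_def W_def Y_def by (simp add: distrib_left add_divide_distrib)
    also have "(Y + W) / e \<le> e" using WY e by (simp add: pos_divide_le_eq power2_eq_square add.commute)
    finally show ?thesis by (simp add: distrib_left)
  qed
  have "?r = 0"
  proof (rule ccontr)
    assume "?r \<noteq> 0"
    then have "?r > 0" by simp
    \<comment> \<open>The choice of \<open>e\<close> turns the bound into \<open>2 * ?r \<le> ?r\<close>.\<close>
    then have "2 * ?r \<le> ?r / (S + 1) * (S + 1)" using S0 by (intro bound) simp
    also have "\<dots> = ?r" using S0 by simp
    finally show False using \<open>?r > 0\<close> by simp
  qed
  then show "L2_inner \<Omega> \<sigma> (weak_grad \<Omega> v) = - L2_inner \<Omega> ?d v" by simp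
qed

section \<open>Orthogonal projection onto broken polynomials\<close>

lemma measurable_lebesgue_on_cong_AE:
  fixes u v :: "'a::euclidean_space \<Rightarrow> real"
  assumes S: "S \<in> sets lebesgue" and u: "u \<in> borel_measurable (lebesgue_on S)"
    and ae: "AE x in lebesgue_on S. u x = v x"
  shows "v \<in> borel_measurable (lebesgue_on S)"
proof -
  have Sm: "S \<inter> space lebesgue \<in> sets lebesgue" using S by simp
  have "(\<lambda>x. indicator S x *\<^sub>R u x) \<in> borel_measurable lebesgue"
    using u borel_measurable_restrict_space_iff[OF Sm, of u] by (simp add: mult.commute)
  moreover have "AE x in lebesgue. indicator S x *\<^sub>R u x = indicator S x *\<^sub>R v x"
    using ae unfolding AE_restrict_space_iff[OF Sm] by eventually_elim (auto simp: indicator_def)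
  ultimately have "(\<lambda>x. indicator S x *\<^sub>R v x) \<in> borel_measurable lebesgue"
    by (rule borel_measurable_AE)
  then show ?thesis using borel_measurable_restrict_space_iff[OF Sm, of v] by (simp add: mult.commute)
qed

lemma L2_sum:
  fixes b :: "'i \<Rightarrow> 'a::euclidean_space \<Rightarrow> real"
  assumes "finite I" "\<And>i. i \<in> I \<Longrightarrow> b i \<in> L2 S"
  shows "(\<lambda>x. \<Sum>i\<in>I. c i * b i x) \<in> L2 S"
  using assms
proof (induction I)
  case empty
  then show ?case by (simp add: L2_iff)
next
  case (insert i I)
  then show ?case using L2_add[OF L2_scale[of "b i" S "c i"]] by simp
qed

lemma L2_inner_sum_right:
  fixes b :: "'i \<Rightarrow> 'a::euclidean_space \<Rightarrow> real"
  assumes "\<And>i. i \<in> I \<Longrightarrow> b i \<in> L2 S" "u \<in> L2 S"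
  shows "L2_inner S u (\<lambda>x. \<Sum>i\<in>I. c i * b i x) = (\<Sum>i\<in>I. c i * L2_inner S u (b i))"
proof -
  have "L2_inner S u (\<lambda>x. \<Sum>i\<in>I. c i * b i x) = (\<integral>x. (\<Sum>i\<in>I. c i * (u x \<bullet> b i x)) \<partial>lebesgue_on S)"
    unfolding L2_inner_def by (simp add: sum_distrib_left mult.left_commute)
  also have "\<dots> = (\<Sum>i\<in>I. \<integral>x. c i * (u x \<bullet> b i x) \<partial>lebesgue_on S)"
    using assms by (intro Bochner_Integration.integral_sum integrable_mult_right L2_inner_integrable)
  finally show ?thesis by (simp add: L2_inner_def)
qed

lemma L2_inner_null:
  fixes u g :: "'a::euclidean_space \<Rightarrow> real"
  assumes "g \<in> L2 S" "L2_inner S g g = 0"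
  shows "L2_inner S u g = 0"
proof -
  have "AE x in lebesgue_on S. g x \<bullet> g x = 0"
    using assms integral_nonneg_eq_0_iff_AE[OF L2_inner_integrable[OF assms(1,1)]]
    by (simp add: L2_inner_def)
  then show ?thesis unfolding L2_inner_def by (intro integral_eq_zero_AE) auto
qed

text \<open>Gram-Schmidt in coefficients: subtract from the new function \<open>b m\<close> its projection onto the old
  span, and add to the projection of \<open>u\<close> the component along the difference \<open>g\<close>. If \<open>g\<close> is a null
  function, it is orthogonal to everything and nothing has to be added.\<close>

lemma L2_orthogonal_projection_exists:
  fixes b :: "'i \<Rightarrow> 'a::euclidean_space \<Rightarrow> real"
  assumes "finite I" "\<And>i. i \<in> I \<Longrightarrow> b i \<in> L2 S" "u \<in> L2 S"
  shows "\<exists>c. \<forall>j\<in>I. L2_inner S (\<lambda>x. u x - (\<Sum>i\<in>I. c i * b i x)) (b j) = 0"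
  using assms
proof (induction I arbitrary: u)
  case empty
  then show ?case by simp
next
  case (insert m I)
  have bI: "\<And>i. i \<in> I \<Longrightarrow> b i \<in> L2 S" and bm: "b m \<in> L2 S" using insert.prems by auto
  obtain c where c: "\<And>j. j \<in> I \<Longrightarrow> L2_inner S (\<lambda>x. u x - (\<Sum>i\<in>I. c i * b i x)) (b j) = 0"
    using insert.IH[OF bI insert.prems(2)] by blast
  obtain d where d: "\<And>j. j \<in> I \<Longrightarrow> L2_inner S (\<lambda>x. b m x - (\<Sum>i\<in>I. d i * b i x)) (b j) = 0"
    using insert.IH[OF bI bm] by blast
  define u' where "u' x = u x - (\<Sum>i\<in>I. c i * b i x)" for x
  define g where "g x = b m x - (\<Sum>i\<in>I. d i * b i x)" for x
  have L: "u' \<in> L2 S" "g \<in> L2 S"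
    unfolding u'_def[abs_def] g_def[abs_def]
    using insert.hyps(1) bI bm insert.prems(2) by (auto intro!: L2_diff L2_sum)
  define t where "t = (if L2_inner S g g = 0 then 0 else L2_inner S u' g / L2_inner S g g)"
  define r where "r x = u' x - t *\<^sub>R g x" for x
  have rL: "r \<in> L2 S" unfolding r_def[abs_def] by (intro L2_diff L2_scale L)
  have r_inner: "L2_inner S r v = L2_inner S u' v - t * L2_inner S g v" if "v \<in> L2 S" for v
    unfolding r_def[abs_def]
    using L2_inner_diff_left[OF L(1) L2_scale[OF L(2), of t] that] L2_inner_scale_left[where c = t and u = g] by simp
  have rj: "L2_inner S r (b j) = 0" if "j \<in> I" for j
    using c d that unfolding r_inner[OF bI[OF that]] u'_def[abs_def] g_def[abs_def] by simp
  have "L2_inner S r g = 0"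
    unfolding r_inner[OF L(2)] t_def using L2_inner_null[OF L(2)] by auto
  moreover have "L2_inner S r g = L2_inner S r (b m) - L2_inner S r (\<lambda>x. \<Sum>i\<in>I. d i * b i x)"
    unfolding g_def[abs_def] by (rule L2_inner_diff_right[OF bm _ rL]) (use insert.hyps(1) bI in \<open>auto intro: L2_sum\<close>)
  moreover have "L2_inner S r (\<lambda>x. \<Sum>i\<in>I. d i * b i x) = 0"
    using L2_inner_sum_right[OF bI rL, where c = d] rj by simp
  ultimately have rm: "L2_inner S r (b m) = 0" by simp
  define e where "e i = (if i = m then t else c i - t * d i)" for i
  have "(\<Sum>i\<in>insert m I. e i * b i x) = t * b m x + (\<Sum>i\<in>I. (c i - t * d i) * b i x)" for x
    using insert.hyps by (simp add: e_def) (intro sum.cong, auto)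
  then have "u x - (\<Sum>i\<in>insert m I. e i * b i x) = r x" for x
    by (simp add: r_def u'_def g_def algebra_simps sum_subtractf sum_distrib_left)
  then show ?case using rj rm by (intro exI[of _ e]) (auto simp: fun_eq_iff)
qed

text \<open>For the last claim: two distinct simplices of full dimension meet in a common
  face; it is a proper face of at least one of them, hence of lower dimension, hence a null set.\<close>

lemma triangulationD:
  fixes \<Omega> :: "(real^'d::finite) set"
  assumes "domain_triangulation \<Omega> Th"
  shows "finite Th" "\<Omega> \<subseteq> \<Union>Th" "\<And>E. E \<in> Th \<Longrightarrow> compact E" "\<And>E. E \<in> Th \<Longrightarrow> E \<in> sets lebesgue"
    "\<And>E F. E \<in> Th \<Longrightarrow> F \<in> Th \<Longrightarrow> E \<noteq> F \<Longrightarrow> negligible (E \<inter> F)"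
proof -
  show "finite Th" using assms by (simp add: domain_triangulation_def triangulation_def)
  show "\<Omega> \<subseteq> \<Union>Th" using assms closure_subset by (auto simp: domain_triangulation_def)
  have S: "int CARD('d) simplex E" if "E \<in> Th" for E using that assms by (simp add: domain_triangulation_def)
  have conv: "convex E" if "E \<in> Th" for E
    using S[OF that] simplex_imp_polytope polytope_imp_convex by blast
  show comp: "compact E" if "E \<in> Th" for E
    using S[OF that] simplex_imp_polytope polytope_imp_compact by blast
  then show "E \<in> sets lebesgue" if "E \<in> Th" for E
    using that by (intro fmeasurableD lmeasurable_compact)
  show "negligible (E \<inter> F)" if EF: "E \<in> Th" "F \<in> Th" "E \<noteq> F" for E F
  proof -
    have face: "(E \<inter> F) face_of E" "(E \<inter> F) face_of F"
      using assms EF unfolding domain_triangulation_def triangulation_def by (metis Int_commute)+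
    have dim: "aff_dim E = int CARD('d)" "aff_dim F = int CARD('d)"
      using aff_dim_simplex[OF S] EF by auto
    have "aff_dim (E \<inter> F) < int CARD('d)"
    proof (cases "E \<inter> F = E")
      case True
      then have "E \<inter> F \<noteq> F" using EF by auto
      then show ?thesis using face_of_aff_dim_lt[OF conv[OF EF(2)] face(2)] dim by simp
    next
      case False
      then show ?thesis using face_of_aff_dim_lt[OF conv[OF EF(1)] face(1)] dim by simp
    qed
    then have "interior (E \<inter> F) = {}" by (intro low_dim_interior) simp
    then show ?thesis using conv EF by (simp add: negligible_convex_interior convex_Int)
  qed
qed

lemma triangulation_AE_disjoint:
  assumes "domain_triangulation \<Omega> Th"
  shows "AE x in lebesgue. \<forall>E\<in>Th. \<forall>F\<in>Th. x \<in> E \<longrightarrow> x \<in> F \<longrightarrow> E = F"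
proof -
  note T = triangulationD[OF assms]
  have "AE x in lebesgue. x \<in> E \<longrightarrow> x \<in> F \<longrightarrow> E = F" if "E \<in> Th" "F \<in> Th" for E F
  proof (cases "E = F")
    case False
    then have "AE x in lebesgue. x \<notin> E \<inter> F"
      using T(5) that by (intro AE_not_in) (simp add: negligible_iff_null_sets)
    then show ?thesis by eventually_elim blast
  qed simp
  then show ?thesis using countable_finite[OF T(1)] by (intro AE_ball_countable')
qed

definition multi_monomial :: "('d \<Rightarrow> nat) \<Rightarrow> real^'d::finite \<Rightarrow> real" where
  "multi_monomial \<alpha> x = (\<Prod>k\<in>UNIV. (x $ k) ^ \<alpha> k)"

abbreviation multi_indices :: "nat \<Rightarrow> ('d::finite \<Rightarrow> nat) set" where
  "multi_indices p \<equiv> {\<alpha>. sum \<alpha> UNIV \<le> p}"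

lemma finite_multi_indices: "finite (multi_indices p :: ('d::finite \<Rightarrow> nat) set)"
proof (rule finite_subset)
  show "multi_indices p \<subseteq> PiE (UNIV::'d set) (\<lambda>_. {..p})"
  proof
    fix \<alpha> :: "'d \<Rightarrow> nat" assume a: "\<alpha> \<in> multi_indices p"
    have "\<alpha> k \<le> sum \<alpha> UNIV" for k by (rule member_le_sum) auto
    then have "\<alpha> k \<le> p" for k using a order_trans[of "\<alpha> k" "sum \<alpha> UNIV" p] by simp
    then show "\<alpha> \<in> PiE UNIV (\<lambda>_. {..p})" by (simp add: PiE_iff)
  qed
qed (intro finite_PiE, auto)

lemma polys_iff: "q \<in> polys p \<longleftrightarrow> (\<exists>c. q = (\<lambda>x. \<Sum>\<alpha>\<in>multi_indices p. c \<alpha> * multi_monomial \<alpha> x))"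
  by (simp add: polys_def multi_monomial_def)

lemma continuous_on_multi_monomial: "continuous_on A (multi_monomial \<alpha>)"
  unfolding multi_monomial_def by (intro continuous_intros)

lemma continuous_on_polys: "q \<in> polys p \<Longrightarrow> continuous_on A q"
  unfolding polys_iff by (auto intro!: continuous_intros continuous_on_multi_monomial)

lemma zero_in_polys: "(\<lambda>x. 0) \<in> polys p"
  unfolding polys_iff by (intro exI[of _ "\<lambda>_. 0"]) simp

text \<open>Modulo null sets, the monomials cut off to single simplices span the broken polynomials. They
  fail to do so pointwise, because neighbouring simplices share their common face.\<close>

definition broken_monomial :: "(real^'d) set \<times> ('d \<Rightarrow> nat) \<Rightarrow> real^'d::finite \<Rightarrow> real" where
  "broken_monomial i x = indicator (fst i) x * multi_monomial (snd i) x"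

lemma sum_broken_monomials:
  assumes "finite Th" "E \<in> Th" "\<forall>E\<in>Th. \<forall>F\<in>Th. x \<in> E \<longrightarrow> x \<in> F \<longrightarrow> E = F" "x \<in> E"
  shows "(\<Sum>i\<in>Th \<times> multi_indices p. c i * broken_monomial i x)
    = (\<Sum>\<alpha>\<in>multi_indices p. c (E, \<alpha>) * multi_monomial \<alpha> x)"
proof -
  have "(\<Sum>i\<in>Th \<times> multi_indices p. c i * broken_monomial i x)
      = (\<Sum>F\<in>Th. \<Sum>\<alpha>\<in>multi_indices p. c (F, \<alpha>) * (indicator F x * multi_monomial \<alpha> x))"
    by (simp add: sum.cartesian_product broken_monomial_def case_prod_beta)
  also have "\<dots> = (\<Sum>F\<in>Th. if F = E then (\<Sum>\<alpha>\<in>multi_indices p. c (E, \<alpha>) * multi_monomial \<alpha> x) else 0)"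
    using assms by (intro sum.cong refl) (auto simp: indicator_def)
  finally show ?thesis using assms by simp
qed

lemma broken_monomial_sum_in_broken_polys:
  assumes "domain_triangulation \<Omega> Th"
  shows "(\<lambda>x. \<Sum>i\<in>Th \<times> multi_indices p. c i * broken_monomial i x) \<in> broken_polys Th p"
  unfolding broken_polys_def mem_Collect_eq
proof
  note T = triangulationD[OF assms]
  fix E assume E: "E \<in> Th"
  have "AE x in lebesgue_on E. (\<Sum>i\<in>Th \<times> multi_indices p. c i * broken_monomial i x)
    = (\<Sum>\<alpha>\<in>multi_indices p. c (E, \<alpha>) * multi_monomial \<alpha> x)"
    unfolding AE_restrict_space_iff[of E lebesgue, simplified, OF T(4)[OF E]]
    using triangulation_AE_disjoint[OF assms]
    by eventually_elim (use sum_broken_monomials[OF T(1) E] in blast)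
  then show "\<exists>q\<in>polys p. AE x in lebesgue_on E. (\<Sum>i\<in>Th \<times> multi_indices p. c i * broken_monomial i x) = q x"
    by (intro bexI) (auto simp: polys_iff)
qed

lemma broken_polys_expansion:
  assumes mesh: "domain_triangulation \<Omega> Th" and \<Omega>: "\<Omega> \<in> sets lebesgue" and v: "v \<in> broken_polys Th p"
  shows "\<exists>c. AE x in lebesgue_on \<Omega>. v x = (\<Sum>i\<in>Th \<times> multi_indices p. c i * broken_monomial i x)"
proof -
  note T = triangulationD[OF mesh]
  have "\<forall>E\<in>Th. \<exists>c. AE x in lebesgue_on E. v x = (\<Sum>\<alpha>\<in>multi_indices p. c \<alpha> * multi_monomial \<alpha> x)"
  proof
    fix E assume "E \<in> Th"
    then obtain q where q: "q \<in> polys p" "AE x in lebesgue_on E. v x = q x"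
      using v unfolding broken_polys_def by blast
    from q(1) obtain c where "q = (\<lambda>x. \<Sum>\<alpha>\<in>multi_indices p. c \<alpha> * multi_monomial \<alpha> x)"
      unfolding polys_iff by blast
    with q(2) show "\<exists>c. AE x in lebesgue_on E. v x = (\<Sum>\<alpha>\<in>multi_indices p. c \<alpha> * multi_monomial \<alpha> x)"
      by (intro exI[of _ c]) simp
  qed
  from bchoice[OF this] obtain c where c: "\<And>E. E \<in> Th \<Longrightarrow>
      AE x in lebesgue_on E. v x = (\<Sum>\<alpha>\<in>multi_indices p. c E \<alpha> * multi_monomial \<alpha> x)"
    by blast
  have "AE x in lebesgue. x \<in> E \<longrightarrow> v x = (\<Sum>\<alpha>\<in>multi_indices p. c E \<alpha> * multi_monomial \<alpha> x)" if "E \<in> Th" for E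
    using c[OF that] T(4)[OF that] by (simp add: AE_restrict_space_iff)
  then have "AE x in lebesgue. \<forall>E\<in>Th. x \<in> E \<longrightarrow> v x = (\<Sum>\<alpha>\<in>multi_indices p. c E \<alpha> * multi_monomial \<alpha> x)"
    using countable_finite[OF T(1)] by (intro AE_ball_countable')
  then have "AE x in lebesgue. x \<in> \<Omega> \<longrightarrow> v x = (\<Sum>i\<in>Th \<times> multi_indices p. (case i of (E, \<alpha>) \<Rightarrow> c E \<alpha>) * broken_monomial i x)"
    using triangulation_AE_disjoint[OF mesh]
  proof eventually_elim
    case (elim x)
    show ?case
    proof
      assume "x \<in> \<Omega>"
      then obtain E where E: "E \<in> Th" "x \<in> E" using T(2) by blast
      show "v x = (\<Sum>i\<in>Th \<times> multi_indices p. (case i of (E, \<alpha>) \<Rightarrow> c E \<alpha>) * broken_monomial i x)"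
        unfolding sum_broken_monomials[OF T(1) E(1) elim(2) E(2)] using elim(1) E by simp
    qed
  qed
  then show ?thesis using \<Omega> by (intro exI) (simp add: AE_restrict_space_iff)
qed

lemma broken_monomial_L2:
  assumes mesh: "domain_triangulation \<Omega> Th" and \<Omega>: "\<Omega> \<in> lmeasurable" and i: "i \<in> Th \<times> multi_indices p"
  shows "broken_monomial i \<in> L2 \<Omega>"
proof -
  have E: "compact (fst i)" using triangulationD(3)[OF mesh] i by auto
  have "bounded (multi_monomial (snd i) ` fst i)"
    by (intro compact_imp_bounded compact_continuous_image continuous_on_multi_monomial E)
  then obtain c where c: "\<And>x. x \<in> fst i \<Longrightarrow> \<bar>multi_monomial (snd i) x\<bar> \<le> c" unfolding bounded_iff by auto
  show ?thesis
  proof (rule L2_bounded[OF \<Omega>])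
    have "broken_monomial i \<in> borel_measurable borel"
      unfolding broken_monomial_def[abs_def]
      using borel_measurable_continuous_onI[OF continuous_on_multi_monomial] E
      by (intro borel_measurable_times borel_measurable_indicator) (auto intro: borel_compact)
    then show "broken_monomial i \<in> borel_measurable (lebesgue_on \<Omega>)"
      by (intro measurable_restrict_space1 measurable_completion) simp
    show "norm (broken_monomial i x) \<le> max 0 c" for x
      using c[of x] by (auto simp: broken_monomial_def indicator_def)
  qed
qed

text \<open>Existence of the projection is what gives meaning to the choice operator in \<open>L2_projection\<close>:
  modulo null sets, the broken polynomials are spanned by finitely many broken monomials.\<close>

lemma L2_projection_works:
  assumes mesh: "domain_triangulation \<Omega> Th" and \<Omega>: "\<Omega> \<in> lmeasurable" and u: "u \<in> L2 \<Omega>"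
  shows "L2_projection \<Omega> Th p u \<in> broken_polys Th p"
    "\<And>v. v \<in> broken_polys Th p \<Longrightarrow> L2_inner \<Omega> (L2_projection \<Omega> Th p u) v = L2_inner \<Omega> u v"
proof -
  let ?I = "Th \<times> (multi_indices p :: ('a \<Rightarrow> nat) set)"
  have fin: "finite ?I" using triangulationD(1)[OF mesh] finite_multi_indices by auto
  have bL: "broken_monomial i \<in> L2 \<Omega>" if "i \<in> ?I" for i by (rule broken_monomial_L2[OF mesh \<Omega> that])
  have \<Omega>s: "\<Omega> \<in> sets lebesgue" using \<Omega> by (rule fmeasurableD)
  from L2_orthogonal_projection_exists[OF fin bL u]
  obtain c where c: "\<forall>j\<in>?I. L2_inner \<Omega> (\<lambda>x. u x - (\<Sum>i\<in>?I. c i * broken_monomial i x)) (broken_monomial j) = 0"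
    by (rule exE)
  define w where "w x = (\<Sum>i\<in>?I. c i * broken_monomial i x)" for x
  have wL: "w \<in> L2 \<Omega>" unfolding w_def[abs_def] by (rule L2_sum[OF fin bL])
  have "L2_inner \<Omega> w v = L2_inner \<Omega> u v" if v: "v \<in> broken_polys Th p" for v
  proof -
    obtain d where d: "AE x in lebesgue_on \<Omega>. v x = (\<Sum>i\<in>?I. d i * broken_monomial i x)"
      using broken_polys_expansion[OF mesh \<Omega>s v] by (rule exE)
    let ?s = "\<lambda>x. \<Sum>i\<in>?I. d i * broken_monomial i x"
    have sL: "?s \<in> L2 \<Omega>" by (rule L2_sum[OF fin bL])
    have vm: "v \<in> borel_measurable (lebesgue_on \<Omega>)"
      by (rule measurable_lebesgue_on_cong_AE[OF \<Omega>s L2_measurable[OF sL]]) (use d in eventually_elim, simp)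
    have eq: "L2_inner \<Omega> y v = L2_inner \<Omega> y ?s" if "y \<in> L2 \<Omega>" for y
    proof (rule L2_inner_cong_AE)
      show "AE x in lebesgue_on \<Omega>. y x \<bullet> v x = y x \<bullet> ?s x" using d by eventually_elim simp
    qed (intro borel_measurable_inner L2_measurable[OF that] L2_measurable[OF sL] vm)+
    have "L2_inner \<Omega> (\<lambda>x. u x - w x) ?s = 0"
      using L2_inner_sum_right[where b = broken_monomial and I = ?I and c = d, OF bL L2_diff[OF u wL]] c
      by (simp add: w_def)
    then show ?thesis using L2_inner_diff_left[OF u wL sL] eq[OF u] eq[OF wL] by simp
  qed
  moreover have "w \<in> broken_polys Th p"
    unfolding w_def[abs_def] by (rule broken_monomial_sum_in_broken_polys[OF mesh])
  ultimately have "\<exists>w. w \<in> broken_polys Th p \<and> (\<forall>v\<in>broken_polys Th p. L2_inner \<Omega> w v = L2_inner \<Omega> u v)"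
    by blast
  from someI_ex[OF this]
  show "L2_projection \<Omega> Th p u \<in> broken_polys Th p"
    "\<And>v. v \<in> broken_polys Th p \<Longrightarrow> L2_inner \<Omega> (L2_projection \<Omega> Th p u) v = L2_inner \<Omega> u v"
    unfolding L2_projection_def by auto
qed

lemma broken_polys_measurable:
  assumes mesh: "domain_triangulation \<Omega> Th" and \<Omega>: "\<Omega> \<in> lmeasurable" and v: "v \<in> broken_polys Th p"
  shows "v \<in> borel_measurable (lebesgue_on \<Omega>)"
proof -
  have \<Omega>s: "\<Omega> \<in> sets lebesgue" using \<Omega> by (rule fmeasurableD)
  obtain c where c: "AE x in lebesgue_on \<Omega>. v x = (\<Sum>i\<in>Th \<times> multi_indices p. c i * broken_monomial i x)"
    using broken_polys_expansion[OF mesh \<Omega>s v] by (rule exE)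
  have "(\<lambda>x. \<Sum>i\<in>Th \<times> multi_indices p. c i * broken_monomial i x) \<in> L2 \<Omega>"
    using triangulationD(1)[OF mesh] finite_multi_indices
    by (intro L2_sum broken_monomial_L2[OF mesh \<Omega>, of _ p]) auto
  from L2_measurable[OF this] show ?thesis
    by (rule measurable_lebesgue_on_cong_AE[OF \<Omega>s]) (use c in eventually_elim, simp)
qed

lemma fem_space_bounded:
  assumes mesh: "domain_triangulation \<Omega> Th" and v: "v \<in> fem_space \<Omega> Th p"
  shows "\<exists>c. \<forall>x\<in>\<Omega>. \<bar>v x\<bar> \<le> c"
proof -
  note T = triangulationD[OF mesh]
  have "bounded (v ` E)" if E: "E \<in> Th" for E
  proof -
    obtain q where q: "q \<in> polys p" "\<forall>x\<in>E. v x = q x" using v E by (auto simp: fem_space_def)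
    have "bounded (q ` E)"
      by (intro compact_imp_bounded compact_continuous_image continuous_on_polys[OF q(1)] T(3)[OF E])
    then show ?thesis using q(2) by (metis image_cong)
  qed
  then have "bounded (v ` \<Union>Th)" using T(1) by (simp add: image_Union bounded_Union)
  then obtain c where "\<And>x. x \<in> \<Union>Th \<Longrightarrow> \<bar>v x\<bar> \<le> c" unfolding bounded_iff by auto
  then show ?thesis using T(2) by blast
qed

text \<open>Cutting off to a union of elements keeps a finite element function a broken polynomial. It is
  therefore an admissible test function for the projection in the divergence of the flux.\<close>

lemma fem_space_restrict_broken_polys:
  assumes mesh: "domain_triangulation \<Omega> Th" and v: "v \<in> fem_space \<Omega> Th p" and D: "D \<subseteq> Th"
  shows "(\<lambda>x. if x \<in> \<Union>D then v x else 0) \<in> broken_polys Th p"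
  unfolding broken_polys_def mem_Collect_eq
proof
  note T = triangulationD[OF mesh]
  fix E assume E: "E \<in> Th"
  show "\<exists>q\<in>polys p. AE x in lebesgue_on E. (if x \<in> \<Union>D then v x else 0) = q x"
  proof (cases "E \<in> D")
    case True
    obtain q where "q \<in> polys p" "\<forall>x\<in>E. v x = q x" using v E by (auto simp: fem_space_def)
    then show ?thesis using True by (intro bexI[of _ q] AE_I2) auto
  next
    case False
    have "AE x in lebesgue_on E. (if x \<in> \<Union>D then v x else 0) = 0"
      unfolding AE_restrict_space_iff[of E lebesgue, simplified, OF T(4)[OF E]]
      using triangulation_AE_disjoint[OF mesh]
    proof eventually_elim
      case (elim x)
      have "x \<notin> \<Union>D" if "x \<in> E" using elim that D E False by blast
      then show ?case by simp
    qed
    then show ?thesis using zero_in_polys by (intro bexI[of _ "\<lambda>x. 0"])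
  qed
qed

section \<open>Young's inequality and absorption\<close>

lemma young_ineq: "0 < s \<Longrightarrow> a * b \<le> a\<^sup>2 / (2 * s) + s / 2 * (b::real)\<^sup>2"
proof -
  assume s: "0 < s"
  have "0 \<le> (a - s * b)\<^sup>2 / (2 * s)" using s by simp
  also have "\<dots> = a\<^sup>2 / (2 * s) + s / 2 * b\<^sup>2 - a * b"
    using s by (simp add: power2_diff power_mult_distrib field_simps power2_eq_square)
  finally show ?thesis by simp
qed

text \<open>The three terms are bounded separately. The hypothesis on \<open>X\<close> makes the second one at most
  \<open>C\<close> times the product of the two square roots whose squares form the energy density, that is, at
  most \<open>C / 2\<close> times the density; in the first and the last term Young's inequality with weight \<open>D\<close>
  spends \<open>D / 2\<close> times one part of the density each.\<close>

lemma pointwise_energy_bound: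
  fixes A :: "real^'n^'n::finite"
  assumes A: "sym_psd A" "invertible (matrix_sqrt A)" and pos: "0 < \<tau>" "0 \<le> C" "0 < D" "0 \<le> d" "0 \<le> P"
    and X: "\<tau> * (norm (matrix_inv_sqrt A *v X))\<^sup>2 \<le> C\<^sup>2 * d" and e: "e\<^sup>2 \<le> P * d"
  shows "e * w - \<tau> * (w * (X \<bullet> g)) - \<tau> * (F \<bullet> g)
    \<le> (C / 2 + D / 2) * (d * w\<^sup>2 + \<tau> * (norm (matrix_sqrt A *v g))\<^sup>2)
      + (P + \<tau> * (norm (matrix_inv_sqrt A *v F))\<^sup>2) / (2 * D)"
proof -
  define y where "y = norm (matrix_sqrt A *v g)"
  define a where "a = norm (matrix_inv_sqrt A *v X)"
  define b where "b = norm (matrix_inv_sqrt A *v F)"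
  have y0: "0 \<le> y" "0 \<le> a" "0 \<le> b" by (auto simp: y_def a_def b_def)
  have "e * w \<le> \<bar>e\<bar> * \<bar>w\<bar>" by (simp add: abs_mult[symmetric])
  also have "\<dots> \<le> sqrt (P * d) * \<bar>w\<bar>" using real_sqrt_le_mono[OF e] by (intro mult_right_mono) auto
  also have "\<dots> = sqrt P * (sqrt d * \<bar>w\<bar>)" by (simp add: real_sqrt_mult)
  also have "\<dots> \<le> P / (2 * D) + D / 2 * (d * w\<^sup>2)"
    using young_ineq[OF pos(3), of "sqrt P" "sqrt d * \<bar>w\<bar>"] pos by (simp add: power_mult_distrib)
  finally have 1: "e * w \<le> P / (2 * D) + D / 2 * (d * w\<^sup>2)" .
  have "- (X \<bullet> g * w) \<le> a * y * \<bar>w\<bar>"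
  proof -
    have "\<bar>X \<bullet> g\<bar> \<le> a * y"
      unfolding inner_matrix_inv_sqrt[OF A, of X g] a_def y_def by (rule Cauchy_Schwarz_ineq2)
    then have "\<bar>X \<bullet> g\<bar> * \<bar>w\<bar> \<le> a * y * \<bar>w\<bar>" by (intro mult_right_mono) auto
    then show ?thesis using abs_ge_minus_self[of "X \<bullet> g * w"] by (simp add: abs_mult)
  qed
  then have "- (\<tau> * (w * (X \<bullet> g))) \<le> \<tau> * (a * y * \<bar>w\<bar>)"
    using mult_left_mono[of "- (X \<bullet> g * w)" "a * y * \<bar>w\<bar>" \<tau>] pos by (simp add: algebra_simps)
  also have "\<dots> = (sqrt \<tau> * a) * (sqrt \<tau> * y * \<bar>w\<bar>)" using pos by simp
  also have "\<dots> \<le> (C * sqrt d) * (sqrt \<tau> * y * \<bar>w\<bar>)"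
  proof (rule mult_right_mono)
    have "sqrt (\<tau> * a\<^sup>2) \<le> sqrt (C\<^sup>2 * d)" using X by (intro real_sqrt_le_mono) (simp add: a_def)
    then show "sqrt \<tau> * a \<le> C * sqrt d" using y0 pos by (simp add: real_sqrt_mult)
  qed (use y0 pos in auto)
  also have "\<dots> = C * ((sqrt d * \<bar>w\<bar>) * (sqrt \<tau> * y))" by simp
  also have "\<dots> \<le> C * (d * w\<^sup>2 / 2 + \<tau> * y\<^sup>2 / 2)"
    using young_ineq[of 1 "sqrt d * \<bar>w\<bar>" "sqrt \<tau> * y"] pos
    by (intro mult_left_mono) (simp_all add: power_mult_distrib)
  finally have 2: "- (\<tau> * (w * (X \<bullet> g))) \<le> C / 2 * (d * w\<^sup>2 + \<tau> * y\<^sup>2)" by (simp add: algebra_simps)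
  have "- (F \<bullet> g) \<le> b * y"
    using Cauchy_Schwarz_ineq2[of "matrix_inv_sqrt A *v F" "matrix_sqrt A *v g"]
    unfolding inner_matrix_inv_sqrt[OF A, of F g] b_def y_def by linarith
  also have "\<dots> \<le> b\<^sup>2 / (2 * D) + D / 2 * y\<^sup>2" by (rule young_ineq[OF pos(3)])
  finally have "\<tau> * - (F \<bullet> g) \<le> \<tau> * (b\<^sup>2 / (2 * D) + D / 2 * y\<^sup>2)" using pos by (intro mult_left_mono) auto
  then have 3: "- (\<tau> * (F \<bullet> g)) \<le> \<tau> * b\<^sup>2 / (2 * D) + D / 2 * (\<tau> * y\<^sup>2)" by (simp add: algebra_simps)
  show ?thesis using 1 2 3 unfolding y_def[symmetric] b_def[symmetric]
    by (simp add: algebra_simps add_divide_distrib)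
qed

text \<open>Integrating the bound and absorbing the multiple \<open>1 - D / 2\<close> of the energy leaves \<open>D / 2\<close> times
  the energy on the left, and multiplication by \<open>2 * D\<close> gives the result. For \<open>Z\<close> without
  measurability the nonnegative integral is a lower integral, which is monotone but not additive;
  the measurable function \<open>max 0 (h - P) / \<tau>\<close> is therefore split off before \<open>Z\<close> is compared.\<close>

lemma energy_absorption:
  fixes a r P Z :: "'a \<Rightarrow> real"
  assumes int: "integrable M a" "integrable M r" "integral\<^sup>L M r = integral\<^sup>L M a"
    and P: "P \<in> borel_measurable M" "\<And>x. 0 \<le> P x" and a0: "\<And>x. 0 \<le> a x" and pos: "0 < \<tau>" "0 < D"
    and bound: "AE x in M. r x \<le> (1 - D / 2) * a x + (P x + \<tau> * Z x) / (2 * D)"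
    and Z0: "\<And>x. 0 \<le> Z x"
  shows "ennreal (D\<^sup>2) * (\<integral>\<^sup>+ x. ennreal (a x) \<partial>M) \<le> (\<integral>\<^sup>+ x. ennreal (P x) \<partial>M) + ennreal \<tau> * (\<integral>\<^sup>+ x. ennreal (Z x) \<partial>M)"
proof -
  define h where "h x = 2 * D * (r x - (1 - D / 2) * a x)" for x
  have h: "integrable M h" unfolding h_def[abs_def] using int by auto
  have hm: "h \<in> borel_measurable M" using h by auto
  have hP: "AE x in M. h x \<le> P x + \<tau> * Z x"
    using bound
  proof eventually_elim
    case (elim x)
    then have "r x - (1 - D / 2) * a x \<le> (P x + \<tau> * Z x) / (2 * D)" by simp
    then show ?case using pos by (simp add: h_def pos_le_divide_eq mult.commute)
  qed
  have "D\<^sup>2 * integral\<^sup>L M a = integral\<^sup>L M h"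
    unfolding h_def using int by (simp add: field_simps power2_eq_square)
  then have "ennreal (D\<^sup>2) * (\<integral>\<^sup>+ x. ennreal (a x) \<partial>M) = ennreal (integral\<^sup>L M h)"
    using int a0 by (simp add: nn_integral_eq_integral ennreal_mult[symmetric] integral_nonneg)
  also have "\<dots> \<le> ennreal (integral\<^sup>L M (\<lambda>x. max 0 (h x)))"
    using h by (intro ennreal_leI integral_mono) auto
  also have "\<dots> = (\<integral>\<^sup>+ x. ennreal (max 0 (h x)) \<partial>M)"
    using h by (intro nn_integral_eq_integral[symmetric]) auto
  also have "\<dots> \<le> (\<integral>\<^sup>+ x. ennreal (P x) + ennreal \<tau> * ennreal (max 0 (h x - P x) / \<tau>) \<partial>M)"
  proof (rule nn_integral_mono)
    fix x
    have "max 0 (h x) \<le> P x + \<tau> * (max 0 (h x - P x) / \<tau>)" using pos P(2)[of x] by auto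
    then have "ennreal (max 0 (h x)) \<le> ennreal (P x + \<tau> * (max 0 (h x - P x) / \<tau>))" by (rule ennreal_leI)
    also have "\<dots> = ennreal (P x) + ennreal \<tau> * ennreal (max 0 (h x - P x) / \<tau>)"
      using pos P(2)[of x] by (subst ennreal_plus) (auto simp: ennreal_mult[symmetric])
    finally show "ennreal (max 0 (h x)) \<le> ennreal (P x) + ennreal \<tau> * ennreal (max 0 (h x - P x) / \<tau>)" .
  qed
  also have "\<dots> = (\<integral>\<^sup>+ x. ennreal (P x) \<partial>M) + ennreal \<tau> * (\<integral>\<^sup>+ x. ennreal (max 0 (h x - P x) / \<tau>) \<partial>M)"
    using hm P(1) by (subst nn_integral_add) (auto simp: nn_integral_cmult)
  also have "\<dots> \<le> (\<integral>\<^sup>+ x. ennreal (P x) \<partial>M) + ennreal \<tau> * (\<integral>\<^sup>+ x. ennreal (Z x) \<partial>M)"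
  proof (intro add_left_mono mult_left_mono nn_integral_mono_AE)
    show "AE x in M. ennreal (max 0 (h x - P x) / \<tau>) \<le> ennreal (Z x)"
      using hP
    proof eventually_elim
      case (elim x)
      then have "max 0 (h x - P x) \<le> \<tau> * Z x" using pos Z0[of x] by simp
      then show ?case using pos by (intro ennreal_leI) (simp add: pos_divide_le_eq mult.commute)
    qed
  qed simp
  finally show ?thesis .
qed

lemma ennsqrt_le_of_scaled:
  assumes "0 < D" "ennreal (D\<^sup>2) * A \<le> M"
  shows "ennsqrt A \<le> ennreal (1 / D) * ennsqrt M"
proof (cases M)
  case top
  then show ?thesis using assms(1) by (simp add: ennsqrt_def ennreal_mult_top)
next
  case (real m)
  then have "ennreal (D\<^sup>2) * A < \<infinity>" using assms(2) by (metis ennreal_less_top infinity_ennreal_def le_less_trans)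
  then have "A \<noteq> \<infinity>" using assms(1) by (auto simp: ennreal_mult_top)
  then obtain b where b: "A = ennreal b" "0 \<le> b" by (cases A) auto
  have "D\<^sup>2 * b \<le> m" using assms b real by (simp add: ennreal_mult[symmetric])
  then have "sqrt (D\<^sup>2 * b) \<le> sqrt m" by simp
  then have "sqrt b \<le> 1 / D * sqrt m" using assms(1) by (simp add: real_sqrt_mult pos_le_divide_eq mult.commute)
  then show ?thesis using b real assms(1) by (simp add: ennsqrt_def ennreal_mult[symmetric] ennreal_leI)
qed

section \<open>The error estimate\<close>

text \<open>By Green's formula the left-hand side is minus the projection of \<open>R\<close>, tested with \<open>v\<close> on the
  elements of \<open>D\<close>. Since \<open>v\<close> cut off to these elements is a broken polynomial, the projection may be dropped.\<close>

lemma flux_balance: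
  assumes \<Omega>: "open \<Omega>" "bounded \<Omega>" and mesh: "domain_triangulation \<Omega> Th" and \<tau>: "\<tau> \<noteq> 0"
    and R: "R \<in> L2 \<Omega>" and D: "D \<subseteq> Th" and \<sigma>: "\<sigma> \<in> H_div \<Omega>" and v: "v \<in> fem_space \<Omega> Th p"
    and div: "AE x in lebesgue_on \<Omega>. weak_div \<Omega> \<sigma> x =
      (if x \<in> \<Union>D then 1 / \<tau> * L2_projection \<Omega> Th p R x else 0)"
  shows "\<tau> * L2_inner \<Omega> \<sigma> (weak_grad \<Omega> v) = - L2_inner \<Omega> (\<lambda>x. if x \<in> \<Union>D then R x else 0) v"
proof -
  have m: "\<Omega> \<in> lmeasurable" using \<Omega> by (simp add: lmeasurable_open)
  let ?v = "\<lambda>x. if x \<in> \<Union>D then v x else 0" and ?P = "L2_projection \<Omega> Th p R"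
  have v0: "v \<in> H1_0 \<Omega>" using v by (simp add: fem_space_def)
  then have vL: "v \<in> L2 \<Omega>" by (simp add: H1_0_def H1_def)
  note green = weak_div_green[OF \<Omega> v0 \<sigma>]
  note vb = fem_space_restrict_broken_polys[OF mesh v D]
  note proj = L2_projection_works[OF mesh m R, where p = p]
  have "L2_inner \<Omega> (weak_div \<Omega> \<sigma>) v = L2_inner \<Omega> (\<lambda>x. (1 / \<tau>) *\<^sub>R ?P x) ?v"
  proof (rule L2_inner_cong_AE)
    show "AE x in lebesgue_on \<Omega>. weak_div \<Omega> \<sigma> x \<bullet> v x = ((1 / \<tau>) *\<^sub>R ?P x) \<bullet> ?v x"
      using div by eventually_elim auto
    show "(\<lambda>x. weak_div \<Omega> \<sigma> x \<bullet> v x) \<in> borel_measurable (lebesgue_on \<Omega>)"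
      by (intro borel_measurable_inner L2_measurable green vL)
    show "(\<lambda>x. ((1 / \<tau>) *\<^sub>R ?P x) \<bullet> ?v x) \<in> borel_measurable (lebesgue_on \<Omega>)"
      by (intro borel_measurable_inner borel_measurable_scaleR borel_measurable_const
          broken_polys_measurable[OF mesh m proj(1)] broken_polys_measurable[OF mesh m vb])
  qed
  also have "\<dots> = 1 / \<tau> * L2_inner \<Omega> R ?v"
    using proj(2)[OF vb] L2_inner_scale_left[where c = "1 / \<tau>" and u = ?P] by simp
  also have "L2_inner \<Omega> R ?v = L2_inner \<Omega> (\<lambda>x. if x \<in> \<Union>D then R x else 0) v"
    unfolding L2_inner_def by (rule Bochner_Integration.integral_cong) auto
  finally show ?thesis using green(2) \<tau> by simp
qed

text \<open>Outside the elements of \<open>D\<close>, where the left-hand integrand lives, \<open>\<Omega>\<close> is covered by the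
  remaining closed elements, and there the two integrands agree.\<close>

lemma poten_estimator_lower_bound:
  fixes d R :: "real^'d::finite \<Rightarrow> real"
  assumes mesh: "domain_triangulation \<Omega> Th" and \<Omega>: "\<Omega> \<in> sets lebesgue" and D: "D \<subseteq> Th"
    and d: "\<And>x. x \<in> \<Union>(Th - D) \<Longrightarrow> 0 < d x"
  shows "(\<integral>\<^sup>+ x. ennreal (if x \<in> \<Union>D then 0 else (R x)\<^sup>2 / d x) \<partial>lebesgue_on \<Omega>)
    \<le> (L2_norm (\<Union>(Th - D)) (\<lambda>x. d x powr (- 1 / 2) * R x))\<^sup>2"
proof -
  note T = triangulationD[OF mesh]
  have S: "\<Union>(Th - D) \<in> sets lebesgue" using T by (intro sets.finite_Union) auto
  have "(\<integral>\<^sup>+ x. ennreal (if x \<in> \<Union>D then 0 else (R x)\<^sup>2 / d x) \<partial>lebesgue_on \<Omega>)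
      = (\<integral>\<^sup>+ x. ennreal (if x \<in> \<Union>D then 0 else (R x)\<^sup>2 / d x) * indicator \<Omega> x \<partial>lebesgue)"
    using \<Omega> by (simp add: nn_integral_restrict_space)
  also have "\<dots> \<le> (\<integral>\<^sup>+ x. ennreal ((norm (d x powr (- 1 / 2) * R x))\<^sup>2) * indicator (\<Union>(Th - D)) x \<partial>lebesgue)"
  proof (rule nn_integral_mono)
    fix x
    show "ennreal (if x \<in> \<Union>D then 0 else (R x)\<^sup>2 / d x) * indicator \<Omega> x
      \<le> ennreal ((norm (d x powr (- 1 / 2) * R x))\<^sup>2) * indicator (\<Union>(Th - D)) x"
    proof (cases "x \<in> \<Omega> \<and> x \<notin> \<Union>D")
      case True
      then have x: "x \<in> \<Union>(Th - D)" using T(2) by blast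
      have "(d x powr (- 1 / 2))\<^sup>2 = d x powr (- 1)"
        by (simp add: power2_eq_square powr_add[symmetric])
      also have "\<dots> = 1 / d x" using d[OF x] by (simp add: powr_minus_divide)
      finally have "(norm (d x powr (- 1 / 2) * R x))\<^sup>2 = (R x)\<^sup>2 / d x"
        by (simp add: power_mult_distrib)
      then show ?thesis using True x by simp
    qed (auto simp: indicator_def)
  qed
  also have "\<dots> = (L2_norm (\<Union>(Th - D)) (\<lambda>x. d x powr (- 1 / 2) * R x))\<^sup>2"
    unfolding L2_norm_def ennsqrt_power2 using S by (simp add: nn_integral_restrict_space)
  finally show ?thesis .
qed

theorem proposition2:
  fixes \<Omega> :: "(real^'d::finite) set" and Th :: "(real^'d) set set" and p :: nat
    and \<theta> d\<theta> :: "real \<Rightarrow> real" and L\<^sub>\<theta> \<theta>\<^sub>m :: real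
    and K dK :: "real \<Rightarrow> real^'d^'d" and \<kappa>\<^sub>m \<kappa>\<^sub>M L\<^sub>\<kappa> :: real
    and up :: "real^'d" and z :: "real^'d \<Rightarrow> real"
    and T \<tau> \<epsilon> C :: real and n i :: nat
    and f :: "real \<Rightarrow> real^'d \<Rightarrow> real"
    and \<psi>prev :: "real^'d \<Rightarrow> real" and \<psi> :: "nat \<Rightarrow> real^'d \<Rightarrow> real"
    and \<sigma> :: "real^'d \<Rightarrow> real^'d" and Tdeg :: "(real^'d) set set"
    and \<eta>_poten \<eta>_flux \<eta> :: ennreal
  assumes domain: "polytopal_lipschitz_domain \<Omega>"
    and mesh: "domain_triangulation \<Omega> Th"
    and height: "norm up = 1" "z = (\<lambda>x. up \<bullet> x)"
    and theta_range: "\<And>s. \<theta> s \<in> {0..1}"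
    and theta_lipschitz: "L\<^sub>\<theta>-lipschitz_on UNIV \<theta>"
    and theta_mono: "mono \<theta>"
    and theta_deriv: "d\<theta> \<in> borel_measurable borel"
      "AE s in lborel. (\<theta> has_real_derivative d\<theta> s) (at s)"
      "0 \<le> \<theta>\<^sub>m" "\<And>s. \<theta>\<^sub>m \<le> d\<theta> s" "\<And>s. d\<theta> s \<le> L\<^sub>\<theta>"
    and K_sym: "\<And>s. s \<in> {0..1} \<Longrightarrow> transpose (K s) = K s"
    and K_bounds: "0 \<le> \<kappa>\<^sub>m" "\<kappa>\<^sub>m < \<kappa>\<^sub>M"
      "\<And>s y. s \<in> {0..1} \<Longrightarrow> \<kappa>\<^sub>m * (norm y)\<^sup>2 \<le> y \<bullet> (K s *v y)"
      "\<And>s y. s \<in> {0..1} \<Longrightarrow> y \<bullet> (K s *v y) \<le> \<kappa>\<^sub>M * (norm y)\<^sup>2"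
    and K_theta_lipschitz: "L\<^sub>\<kappa>-lipschitz_on UNIV (\<lambda>s. K (\<theta> s))"
    and K_theta_deriv: "dK \<in> borel_measurable borel" "bounded (range dK)"
      "AE s in lborel. ((\<lambda>r. K (\<theta> r)) has_vector_derivative dK s) (at s)"
    and source: "\<And>t. t \<in> {0..T} \<Longrightarrow> f t \<in> L2 \<Omega>"
      "\<And>t. t \<in> {0..T} \<Longrightarrow>
         ((\<lambda>s. L2_norm \<Omega> (\<lambda>x. f s x - f t x)) \<longlongrightarrow> 0) (at t within {0..T})"
    and parameters: "\<tau> > 0" "\<epsilon> > 0" "n \<ge> 1" "real n * \<tau> \<le> T" "i \<ge> 1"
    and iterates: "\<psi>prev \<in> fem_space \<Omega> Th p" "\<And>j. j \<le> i + 1 \<Longrightarrow> \<psi> j \<in> fem_space \<Omega> Th p"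
    and newton: "\<And>j v. j \<in> {1..i+1} \<Longrightarrow> v \<in> fem_space \<Omega> Th p \<Longrightarrow>
        L2_inner \<Omega> (\<lambda>x. d\<theta> (\<psi> (j-1) x) * (\<psi> j x - \<psi> (j-1) x)) v
        + \<tau> * L2_inner \<Omega>
            (\<lambda>x. K (\<theta> (\<psi> (j-1) x)) *v weak_grad \<Omega> (\<lambda>y. \<psi> j y + z y) x)
            (weak_grad \<Omega> v)
        + \<tau> * L2_inner \<Omega>
            (\<lambda>x. (\<psi> j x - \<psi> (j-1) x) *\<^sub>R
               (dK (\<psi> (j-1) x) *v weak_grad \<Omega> (\<lambda>y. \<psi> (j-1) y + z y) x))
            (weak_grad \<Omega> v)
        = \<tau> * L2_inner \<Omega> (f (real n * \<tau>)) v
          - L2_inner \<Omega> (\<lambda>x. \<theta> (\<psi> (j-1) x) - \<theta> (\<psi>prev x)) v"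
    and inv_sqrt_exists: "AE x in lebesgue_on \<Omega>. invertible (matrix_sqrt (K (\<theta> (\<psi> i x))))"
    and C_range: "0 \<le> C" "C < 2"
    and C_bound: "AE x in lebesgue_on \<Omega>.
        \<tau> * (norm (matrix_inv_sqrt (K (\<theta> (\<psi> i x))) *v
               (dK (\<psi> i x) *v weak_grad \<Omega> (\<lambda>y. \<psi> i y + z y) x)))\<^sup>2
        \<le> C\<^sup>2 * d\<theta> (\<psi> i x)"
    and Tdeg_def: "Tdeg = {E \<in> Th. (INF x\<in>E. d\<theta> (\<psi> i x)) < \<epsilon>}"
    and flux_space: "\<sigma> \<in> broken_RT Th p \<inter> H_div \<Omega>"
    and flux_div: "AE x in lebesgue_on \<Omega>. weak_div \<Omega> \<sigma> x =
        (if x \<in> \<Union>Tdeg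
         then 1 / \<tau> * L2_projection \<Omega> Th p
                (\<lambda>y. d\<theta> (\<psi> (i-1) y) * (\<psi> i y - \<psi> (i-1) y) - (\<theta> (\<psi> i y) - \<theta> (\<psi> (i-1) y))) x
         else 0)"
    and eta_poten_def: "\<eta>_poten = L2_norm (\<Union>(Th - Tdeg))
        (\<lambda>x. d\<theta> (\<psi> i x) powr (- 1 / 2) *
           (d\<theta> (\<psi> (i-1) x) * (\<psi> i x - \<psi> (i-1) x) - (\<theta> (\<psi> i x) - \<theta> (\<psi> (i-1) x))))"
    and eta_flux_def: "\<eta>_flux = L2_norm \<Omega>
        (\<lambda>x. matrix_inv_sqrt (K (\<theta> (\<psi> i x))) *v
           ((K (\<theta> (\<psi> i x)) - K (\<theta> (\<psi> (i-1) x))) *v weak_grad \<Omega> (\<lambda>y. \<psi> i y + z y) x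
            - (\<psi> i x - \<psi> (i-1) x) *\<^sub>R
                (dK (\<psi> (i-1) x) *v weak_grad \<Omega> (\<lambda>y. \<psi> (i-1) y + z y) x)
            + \<sigma> x))"
    and eta_def: "\<eta> = ennreal (2 / (2 - C)) * ennsqrt (\<eta>_poten\<^sup>2 + ennreal \<tau> * \<eta>_flux\<^sup>2)"
  shows "ennsqrt (\<integral>\<^sup>+ x. ennreal (d\<theta> (\<psi> i x) * \<bar>\<psi> (i+1) x - \<psi> i x\<bar>\<^sup>2
            + \<tau> * (norm (matrix_sqrt (K (\<theta> (\<psi> i x))) *v
                     weak_grad \<Omega> (\<lambda>y. \<psi> (i+1) y - \<psi> i y) x))\<^sup>2) \<partial>lebesgue_on \<Omega>)
         \<le> \<eta>"
proof -
  have \<Omega>: "open \<Omega>" "bounded \<Omega>" using domain by (auto simp: polytopal_lipschitz_domain_def)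
  then have lm: "\<Omega> \<in> lmeasurable" by (simp add: lmeasurable_open)
  then have \<Omega>s: "\<Omega> \<in> sets lebesgue" by (rule fmeasurableD)
  note T = triangulationD[OF mesh]
  define M where "M = lebesgue_on \<Omega>"
  define G where "G j = weak_grad \<Omega> (\<lambda>y. \<psi> j y + z y)" for j
  define W where "W x = \<psi> (i+1) x - \<psi> i x" for x
  define g where "g = weak_grad \<Omega> (\<lambda>y. \<psi> (i+1) y - \<psi> i y)"
  define R where "R x = d\<theta> (\<psi> (i-1) x) * (\<psi> i x - \<psi> (i-1) x) - (\<theta> (\<psi> i x) - \<theta> (\<psi> (i-1) x))" for x
  define D where "D = 1 - C / 2"
  have D0: "0 < D" using C_range by (simp add: D_def)

  have H1: "\<psi> j \<in> H1 \<Omega>" if "j \<le> i + 1" for j using iterates(2)[OF that] by (simp add: fem_space_def H1_0_def)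
  note \<psi>L = H1_D(1)[OF H1] and \<psi>G = H1_D(2)[OF H1] and \<psi>GL = H1_D(3)[OF H1]
  have \<psi>m: "\<psi> j \<in> borel_measurable M" if "j \<le> i + 1" for j using L2_measurable[OF \<psi>L[OF that]] by (simp add: M_def)
  have \<psi>prevm: "\<psi>prev \<in> borel_measurable M"
    using iterates(1) by (auto simp: fem_space_def H1_0_def H1_def M_def intro: L2_measurable)
  have zL: "z \<in> L2 \<Omega>" and zG: "has_weak_grad \<Omega> z (gradient z)"
    using height_weak_grad[OF \<Omega>, of up] height(2) by auto
  have GG: "has_weak_grad \<Omega> (\<lambda>y. \<psi> j y + z y) (G j)" if "j \<le> i + 1" for j
    unfolding G_def
    by (rule has_weak_grad_weak_grad[OF has_weak_grad_add[OF \<Omega> \<psi>L[OF that] zL \<psi>G[OF that] zG]])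
  have GL: "G j \<in> L2 \<Omega>" if "j \<le> i + 1" for j using has_weak_gradD(1)[OF GG[OF that]] .
  have WG: "has_weak_grad \<Omega> W (\<lambda>x. weak_grad \<Omega> (\<psi> (i+1)) x - weak_grad \<Omega> (\<psi> i) x)"
    unfolding W_def[abs_def] by (rule has_weak_grad_diff[OF \<Omega>]) (auto intro: \<psi>L \<psi>G)
  have gG: "has_weak_grad \<Omega> W g"
    using has_weak_grad_weak_grad[OF WG] by (simp add: g_def W_def[abs_def])
  have gL: "g \<in> L2 \<Omega>" using gG by (rule has_weak_gradD)
  have WL: "W \<in> L2 \<Omega>" unfolding W_def[abs_def] by (intro L2_diff \<psi>L) auto
  have WGz: "has_weak_grad \<Omega> W (\<lambda>x. G (i+1) x - G i x)"
    using has_weak_grad_diff[OF \<Omega> L2_add[OF \<psi>L zL] L2_add[OF \<psi>L zL] GG GG, of "i+1" i]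
    by (simp add: W_def[abs_def])
  have g_eq: "AE x in M. g x = weak_grad \<Omega> (\<psi> (i+1)) x - weak_grad \<Omega> (\<psi> i) x"
    and g_eqz: "AE x in M. g x = G (i+1) x - G i x"
    unfolding M_def by (rule has_weak_grad_unique[OF \<Omega> gG WG], rule has_weak_grad_unique[OF \<Omega> gG WGz])

  have K\<theta>c: "continuous_on UNIV (\<lambda>s. K (\<theta> s))" using K_theta_lipschitz by (rule lipschitz_on_continuous_on)
  have K\<theta>b: "(\<lambda>s. K (\<theta> s)) \<in> borel_measurable borel" by (rule borel_measurable_continuous_onI[OF K\<theta>c])
  have \<theta>m: "\<theta> \<in> borel_measurable borel"
    by (rule borel_measurable_continuous_onI[OF lipschitz_on_continuous_on[OF theta_lipschitz]])
  have Km: "(\<lambda>x. K (\<theta> (\<psi> j x))) \<in> borel_measurable M" if "j \<le> i + 1" for j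
    using measurable_compose[OF \<psi>m[OF that] K\<theta>b] .
  have Kb: "\<exists>c. \<forall>x\<in>\<Omega>. norm (K (\<theta> (\<psi> j x))) \<le> c" if j: "j \<le> i + 1" for j
  proof -
    obtain b where b: "\<forall>x\<in>\<Omega>. \<bar>\<psi> j x\<bar> \<le> b" using fem_space_bounded[OF mesh iterates(2)[OF j]] by blast
    have "bounded ((\<lambda>s. K (\<theta> s)) ` cball 0 b)"
      by (intro compact_imp_bounded compact_continuous_image continuous_on_subset[OF K\<theta>c]) auto
    then obtain c where "\<forall>s\<in>cball 0 b. norm (K (\<theta> s)) \<le> c" unfolding bounded_iff by auto
    then show ?thesis using b by (intro exI[of _ c]) auto
  qed
  have KGL: "(\<lambda>x. K (\<theta> (\<psi> j x)) *v H x) \<in> L2 \<Omega>" if "j \<le> i + 1" "H \<in> L2 \<Omega>" for j H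
    using Kb[OF that(1)] matrix_vector_mult_L2[OF Km[OF that(1), unfolded M_def] _ that(2)] by blast
  obtain cK where cK: "\<And>s. norm (dK s) \<le> cK" using K_theta_deriv(2) unfolding bounded_iff by auto
  have dKL: "(\<lambda>x. dK (\<psi> j x) *v H x) \<in> L2 \<Omega>" if "j \<le> i + 1" "H \<in> L2 \<Omega>" for j H
    using matrix_vector_mult_L2[OF measurable_compose[OF \<psi>m[OF that(1), unfolded M_def] K_theta_deriv(1)] _ that(2)] cK
    by blast
  have d\<theta>m: "(\<lambda>x. d\<theta> (\<psi> j x)) \<in> borel_measurable M" if "j \<le> i + 1" for j
    using measurable_compose[OF \<psi>m[OF that] theta_deriv(1)] .
  have d\<theta>0: "0 \<le> d\<theta> s" for s using theta_deriv(3) theta_deriv(4)[of s] by linarith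
  have d\<theta>b: "\<bar>d\<theta> s\<bar> \<le> L\<^sub>\<theta>" for s using d\<theta>0[of s] theta_deriv(5)[of s] by simp
  have d\<theta>L: "(\<lambda>x. d\<theta> (\<psi> j x) * u x) \<in> L2 \<Omega>" if "j \<le> i + 1" "u \<in> L2 \<Omega>" for j and u :: "real^'d \<Rightarrow> real"
    using bounded_scaleR_L2[OF d\<theta>m[OF that(1), unfolded M_def] d\<theta>b that(2)] by simp
  have incL: "(\<lambda>x. (\<psi> j x - \<psi> k x) *\<^sub>R (dK (\<psi> k x) *v H x)) \<in> L2 \<Omega>"
    if jk: "j \<le> i + 1" "k \<le> i + 1" and H: "H \<in> L2 \<Omega>" for j k H
  proof -
    obtain b c where b: "\<forall>x\<in>\<Omega>. \<bar>\<psi> j x\<bar> \<le> b" "\<forall>x\<in>\<Omega>. \<bar>\<psi> k x\<bar> \<le> c"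
      using fem_space_bounded[OF mesh iterates(2)[OF jk(1)]] fem_space_bounded[OF mesh iterates(2)[OF jk(2)]] by blast
    show ?thesis
    proof (rule bounded_scaleR_L2[OF _ _ dKL[OF jk(2) H], where c = "b + c"])
      show "(\<lambda>x. \<psi> j x - \<psi> k x) \<in> borel_measurable (lebesgue_on \<Omega>)"
        using \<psi>m[OF jk(1)] \<psi>m[OF jk(2)] by (simp add: M_def)
      show "\<bar>\<psi> j x - \<psi> k x\<bar> \<le> b + c" if "x \<in> \<Omega>" for x
        using b that abs_triangle_ineq4[of "\<psi> j x" "\<psi> k x"] by fastforce
    qed
  qed
  have \<theta>L: "(\<lambda>x. \<theta> (u x) - \<theta> (v x)) \<in> L2 \<Omega>" if "u \<in> borel_measurable M" "v \<in> borel_measurable M" for u v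
  proof (rule L2_bounded[OF lm, where c = 1])
    show "(\<lambda>x. \<theta> (u x) - \<theta> (v x)) \<in> borel_measurable (lebesgue_on \<Omega>)"
      using measurable_compose[OF that(1) \<theta>m] measurable_compose[OF that(2) \<theta>m] by (simp add: M_def)
    show "norm (\<theta> (u x) - \<theta> (v x)) \<le> 1" for x
      using theta_range[of "u x"] theta_range[of "v x"] by auto
  qed
  have RL: "R \<in> L2 \<Omega>" unfolding R_def[abs_def] using \<psi>m by (intro L2_diff d\<theta>L \<theta>L \<psi>L) auto
  have TU: "\<Union>Tdeg \<in> sets lebesgue" using T(1,4) Tdeg_def by (intro sets.finite_Union) auto
  have inU: "(\<lambda>x. if x \<in> \<Union>Tdeg then u x else v x) \<in> borel_measurable M"
    if "u \<in> borel_measurable M" "v \<in> borel_measurable M" for u v :: "real^'d \<Rightarrow> real"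
    using that TU unfolding M_def
    by (intro measurable_If_set) (auto simp: sets_restrict_space)
  have RnL: "(\<lambda>x. if x \<in> \<Union>Tdeg then 0 else R x) \<in> L2 \<Omega>"
  proof (rule L2_dominated[OF RL, where c = 1])
    show "(\<lambda>x. if x \<in> \<Union>Tdeg then 0 else R x) \<in> borel_measurable (lebesgue_on \<Omega>)"
      using L2_measurable[OF RL] unfolding M_def[symmetric] by (intro inU) auto
  qed simp
  have RdL: "(\<lambda>x. if x \<in> \<Union>Tdeg then R x else 0) \<in> L2 \<Omega>"
  proof (rule L2_dominated[OF RL, where c = 1])
    show "(\<lambda>x. if x \<in> \<Union>Tdeg then R x else 0) \<in> borel_measurable (lebesgue_on \<Omega>)"
      using L2_measurable[OF RL] unfolding M_def[symmetric] by (intro inU) auto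
  qed simp
  have \<sigma>L: "\<sigma> \<in> L2 \<Omega>" and \<sigma>H: "\<sigma> \<in> H_div \<Omega>" using flux_space by (auto simp: H_div_def)

  \<comment> \<open>Accumulation, diffusion and convection term and time difference of the \<open>j\<close>-th Newton equation.\<close>
  define A where "A j x = d\<theta> (\<psi> (j-1) x) * (\<psi> j x - \<psi> (j-1) x)" for j x
  define B where "B j x = K (\<theta> (\<psi> (j-1) x)) *v G j x" for j x
  define E where "E j x = (\<psi> j x - \<psi> (j-1) x) *\<^sub>R (dK (\<psi> (j-1) x) *v G (j-1) x)" for j x
  define Q where "Q j x = \<theta> (\<psi> (j-1) x) - \<theta> (\<psi>prev x)" for j x
  have L: "A j \<in> L2 \<Omega>" "B j \<in> L2 \<Omega>" "E j \<in> L2 \<Omega>" "Q j \<in> L2 \<Omega>" if "j \<le> i + 1" for j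
    unfolding A_def[abs_def] B_def[abs_def] E_def[abs_def] Q_def[abs_def]
    using that by (auto intro!: d\<theta>L KGL incL \<theta>L[OF \<psi>m \<psi>prevm] L2_diff[OF \<psi>L \<psi>L] GL)
  \<comment> \<open>The scalar and the vector part of the identity tested below; \<open>\<sigma>\<close> has taken over the degenerate
    part of \<open>R\<close>.\<close>
  define Y where "Y x = A (i+1) x - (if x \<in> \<Union>Tdeg then 0 else R x)" for x
  define X where "X x = B (i+1) x - B i x + (E (i+1) x - E i x) + \<sigma> x" for x
  have YL: "Y \<in> L2 \<Omega>" unfolding Y_def[abs_def] by (rule L2_diff[OF L(1) RnL]) simp
  have XL: "X \<in> L2 \<Omega>" unfolding X_def[abs_def] by (intro L2_diff L2_add L \<sigma>L) auto

  \<comment> \<open>The difference of two consecutive Newton equations, with the linearisation error on the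
    degenerate elements replaced by the equilibrated flux.\<close>
  have resid: "L2_inner \<Omega> Y v + \<tau> * L2_inner \<Omega> X (weak_grad \<Omega> v) = 0" if v: "v \<in> fem_space \<Omega> Th p" for v
  proof -
    have vH: "v \<in> H1 \<Omega>" using v by (simp add: fem_space_def H1_0_def)
    note vL = H1_D(1)[OF vH] and vG = H1_D(3)[OF vH]
    let ?g = "weak_grad \<Omega> v"
    have N: "L2_inner \<Omega> (A j) v + \<tau> * L2_inner \<Omega> (B j) ?g + \<tau> * L2_inner \<Omega> (E j) ?g
        = \<tau> * L2_inner \<Omega> (f (real n * \<tau>)) v - L2_inner \<Omega> (Q j) v" if "j \<in> {1..i+1}" for j
      using newton[OF that v] by (simp add: A_def[abs_def] B_def[abs_def] E_def[abs_def] Q_def[abs_def] G_def)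
    have N1: "L2_inner \<Omega> (A (i+1)) v + \<tau> * L2_inner \<Omega> (B (i+1)) ?g + \<tau> * L2_inner \<Omega> (E (i+1)) ?g
        = \<tau> * L2_inner \<Omega> (f (real n * \<tau>)) v - L2_inner \<Omega> (Q (i+1)) v" by (rule N) simp
    have N2: "L2_inner \<Omega> (A i) v + \<tau> * L2_inner \<Omega> (B i) ?g + \<tau> * L2_inner \<Omega> (E i) ?g
        = \<tau> * L2_inner \<Omega> (f (real n * \<tau>)) v - L2_inner \<Omega> (Q i) v" by (rule N) (use parameters in simp)
    have "R = (\<lambda>x. A i x - (Q (i+1) x - Q i x))"
      by (simp add: R_def[abs_def] A_def Q_def)
    then have Rv: "L2_inner \<Omega> R v = L2_inner \<Omega> (A i) v - (L2_inner \<Omega> (Q (i+1)) v - L2_inner \<Omega> (Q i) v)"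
      using L vL by (simp add: L2_inner_diff_left L2_diff)
    have "R = (\<lambda>x. (if x \<in> \<Union>Tdeg then 0 else R x) + (if x \<in> \<Union>Tdeg then R x else 0))" by auto
    then have Rs: "L2_inner \<Omega> R v = L2_inner \<Omega> (\<lambda>x. if x \<in> \<Union>Tdeg then 0 else R x) v
        + L2_inner \<Omega> (\<lambda>x. if x \<in> \<Union>Tdeg then R x else 0) v"
      using L2_inner_add_left[OF RnL RdL vL] by simp
    have div: "\<tau> * L2_inner \<Omega> \<sigma> ?g = - L2_inner \<Omega> (\<lambda>x. if x \<in> \<Union>Tdeg then R x else 0) v"
    proof (rule flux_balance[OF \<Omega> mesh _ RL _ \<sigma>H v])
      show "AE x in lebesgue_on \<Omega>. weak_div \<Omega> \<sigma> x = (if x \<in> \<Union>Tdeg then 1 / \<tau> * L2_projection \<Omega> Th p R x else 0)"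
        using flux_div unfolding R_def[abs_def] .
    qed (use parameters Tdeg_def in auto)
    have Yv: "L2_inner \<Omega> Y v = L2_inner \<Omega> (A (i+1)) v - L2_inner \<Omega> (\<lambda>x. if x \<in> \<Union>Tdeg then 0 else R x) v"
      unfolding Y_def[abs_def] by (rule L2_inner_diff_left[OF L(1) RnL vL]) simp
    have Xv: "L2_inner \<Omega> X ?g = L2_inner \<Omega> (B (i+1)) ?g - L2_inner \<Omega> (B i) ?g
        + (L2_inner \<Omega> (E (i+1)) ?g - L2_inner \<Omega> (E i) ?g) + L2_inner \<Omega> \<sigma> ?g"
      unfolding X_def[abs_def] using L vG \<sigma>L by (simp add: L2_inner_add_left L2_inner_diff_left L2_add L2_diff)
    show ?thesis unfolding Yv Xv using N1 N2 Rv Rs div by (simp add: algebra_simps)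
  qed

  \<comment> \<open>The difference of the identities for the two iterates amounts to testing with the increment.\<close>
  have main0: "L2_inner \<Omega> Y W + \<tau> * L2_inner \<Omega> X g = 0"
  proof -
    have Yw: "L2_inner \<Omega> Y W = L2_inner \<Omega> Y (\<psi> (i+1)) - L2_inner \<Omega> Y (\<psi> i)"
      unfolding W_def[abs_def] by (rule L2_inner_diff_right) (auto intro: \<psi>L YL)
    have "L2_inner \<Omega> X g = L2_inner \<Omega> X (\<lambda>x. weak_grad \<Omega> (\<psi> (i+1)) x - weak_grad \<Omega> (\<psi> i) x)"
    proof (rule L2_inner_cong_AE)
      show "AE x in lebesgue_on \<Omega>. X x \<bullet> g x = X x \<bullet> (weak_grad \<Omega> (\<psi> (i+1)) x - weak_grad \<Omega> (\<psi> i) x)"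
        using g_eq unfolding M_def by eventually_elim simp
    qed (intro borel_measurable_inner L2_measurable XL gL L2_diff \<psi>GL; simp)+
    also have "\<dots> = L2_inner \<Omega> X (weak_grad \<Omega> (\<psi> (i+1))) - L2_inner \<Omega> X (weak_grad \<Omega> (\<psi> i))"
      by (rule L2_inner_diff_right) (auto intro: \<psi>GL XL)
    finally have Xg: "L2_inner \<Omega> X g
        = L2_inner \<Omega> X (weak_grad \<Omega> (\<psi> (i+1))) - L2_inner \<Omega> X (weak_grad \<Omega> (\<psi> i))" .
    show ?thesis
      unfolding Yw Xg right_diff_distrib
      using resid[OF iterates(2), of "i+1"] resid[OF iterates(2), of i] by linarith
  qed

  have psd: "sym_psd (K (\<theta> s))" for s
  proof -
    have "0 \<le> y \<bullet> (K (\<theta> s) *v y)" for y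
      using K_bounds(3)[OF theta_range, of y s] K_bounds(1) by (meson order_trans mult_nonneg_nonneg zero_le_power2)
    then show ?thesis using K_sym[OF theta_range] by (simp add: sym_psd_def)
  qed
  define a where "a x = d\<theta> (\<psi> i x) * \<bar>\<psi> (i+1) x - \<psi> i x\<bar>\<^sup>2
      + \<tau> * (norm (matrix_sqrt (K (\<theta> (\<psi> i x))) *v g x))\<^sup>2" for x
  have a_eq: "a = (\<lambda>x. A (i+1) x \<bullet> W x + \<tau> * ((K (\<theta> (\<psi> i x)) *v g x) \<bullet> g x))"
    unfolding a_def[abs_def] norm_matrix_sqrt[OF psd]
    by (simp add: A_def W_def power2_eq_square inner_commute mult.assoc)
  have a_int: "integrable M a"
    unfolding a_eq M_def
    by (intro Bochner_Integration.integrable_add integrable_mult_right L2_inner_integrable L KGL WL gL) auto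
  have a0: "0 \<le> a x" for x using d\<theta>0 parameters(1) by (simp add: a_def)
  \<comment> \<open>Since the residual tested with the increment vanishes, subtracting its density does not change
    the integral of the energy, but it replaces the energy by the terms to be estimated.\<close>
  define r where "r x = a x - (Y x \<bullet> W x + \<tau> * (X x \<bullet> g x))" for x
  have YX_int: "integrable M (\<lambda>x. Y x \<bullet> W x)" "integrable M (\<lambda>x. X x \<bullet> g x)"
    unfolding M_def by (intro L2_inner_integrable YL XL WL gL)+
  have r_int: "integrable M r" unfolding r_def[abs_def] using a_int YX_int by auto
  have r_eq: "integral\<^sup>L M r = integral\<^sup>L M a"
    unfolding r_def[abs_def] using a_int YX_int main0 by (simp add: L2_inner_def M_def)
  define P where "P x = (if x \<in> \<Union>Tdeg then 0 else (R x)\<^sup>2 / d\<theta> (\<psi> i x))" for x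
  define F where "F x = (K (\<theta> (\<psi> i x)) - K (\<theta> (\<psi> (i-1) x))) *v G i x
      - (\<psi> i x - \<psi> (i-1) x) *\<^sub>R (dK (\<psi> (i-1) x) *v G (i-1) x) + \<sigma> x" for x
  define Z where "Z x = (norm (matrix_inv_sqrt (K (\<theta> (\<psi> i x))) *v F x))\<^sup>2" for x
  have nondeg: "\<epsilon> \<le> d\<theta> (\<psi> i x)" if x: "x \<in> \<Union>(Th - Tdeg)" for x
  proof -
    obtain S where S: "S \<in> Th" "S \<notin> Tdeg" "x \<in> S" using x by blast
    have "(INF x\<in>S. d\<theta> (\<psi> i x)) \<le> d\<theta> (\<psi> i x)"
      using S(3) d\<theta>0 by (intro cINF_lower bdd_belowI[of _ 0]) auto
    then show ?thesis using S Tdeg_def by auto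
  qed
  have P0: "0 \<le> P x" for x using d\<theta>0 by (simp add: P_def)
  have Pm: "P \<in> borel_measurable M"
    unfolding P_def[abs_def] using d\<theta>m[of i] L2_measurable[OF RL] by (intro inU) (auto simp: M_def)
  have bound: "AE x in M. r x \<le> (1 - D / 2) * a x + (P x + \<tau> * Z x) / (2 * D)"
    using g_eqz inv_sqrt_exists[folded M_def] C_bound[folded M_def] AE_space[of M]
  proof eventually_elim
    case (elim x)
    let ?K = "K (\<theta> (\<psi> i x))"
    have x: "x \<in> \<Omega>" using elim(4) by (simp add: M_def)
    define e where "e = (if x \<in> \<Union>Tdeg then 0 else R x)"
    have "X x = ?K *v g x + W x *\<^sub>R (dK (\<psi> i x) *v G i x) + F x"
      unfolding X_def B_def E_def F_def W_def elim(1)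
      by (simp add: matrix_vector_mult_diff_distrib matrix_vector_mult_diff_rdistrib algebra_simps)
    then have r: "r x = e * W x - \<tau> * (W x * ((dK (\<psi> i x) *v G i x) \<bullet> g x)) - \<tau> * (F x \<bullet> g x)"
      unfolding r_def a_eq Y_def e_def by (simp add: inner_add_left algebra_simps)
    have "e\<^sup>2 \<le> P x * d\<theta> (\<psi> i x)"
    proof (cases "x \<in> \<Union>Tdeg")
      case False
      then have "x \<in> \<Union>(Th - Tdeg)" using x T(2) by blast
      from nondeg[OF this] have "d\<theta> (\<psi> i x) > 0" using parameters(2) by linarith
      then show ?thesis using False by (simp add: e_def P_def)
    qed (simp add: e_def P_def)
    from pointwise_energy_bound[OF psd elim(2) parameters(1) C_range(1) D0 d\<theta>0 P0 elim(3)[folded G_def] this,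
        of "W x" "g x" "F x"]
    have "r x \<le> (C / 2 + D / 2) * a x + (P x + \<tau> * Z x) / (2 * D)"
      unfolding r Z_def a_def W_def by simp
    then show ?case by (simp add: D_def field_simps)
  qed
  have "ennreal (D\<^sup>2) * (\<integral>\<^sup>+ x. ennreal (a x) \<partial>M)
      \<le> (\<integral>\<^sup>+ x. ennreal (P x) \<partial>M) + ennreal \<tau> * (\<integral>\<^sup>+ x. ennreal (Z x) \<partial>M)"
    by (rule energy_absorption[OF a_int r_int r_eq Pm P0 a0 parameters(1) D0 bound]) (simp add: Z_def)
  also have "(\<integral>\<^sup>+ x. ennreal (Z x) \<partial>M) = \<eta>_flux\<^sup>2"
    unfolding eta_flux_def L2_norm_def ennsqrt_power2 Z_def F_def G_def M_def ..
  also have "(\<integral>\<^sup>+ x. ennreal (P x) \<partial>M) + ennreal \<tau> * \<eta>_flux\<^sup>2 \<le> \<eta>_poten\<^sup>2 + ennreal \<tau> * \<eta>_flux\<^sup>2"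
    unfolding P_def M_def eta_poten_def R_def[symmetric]
    using nondeg parameters(2) Tdeg_def
    by (intro add_right_mono poten_estimator_lower_bound[OF mesh \<Omega>s]) (auto intro: less_le_trans)
  finally have "ennsqrt (\<integral>\<^sup>+ x. ennreal (a x) \<partial>M) \<le> ennreal (1 / D) * ennsqrt (\<eta>_poten\<^sup>2 + ennreal \<tau> * \<eta>_flux\<^sup>2)"
    by (rule ennsqrt_le_of_scaled[OF D0])
  moreover have "1 / D = 2 / (2 - C)" using C_range by (simp add: D_def field_simps)
  ultimately show ?thesis unfolding eta_def a_def g_def M_def by simp
qed

end
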